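(* Let $n \geq 2$, let $p, q \in B_T^n$ and let $\gamma \in \Gamma(p,q)$. Then $\mathcal{L}(\gamma) \geq \mathcal{L}(\lambda_{p,q})$, with equality if and only if $\gamma$ is fully monotonic and passes through the point $m(p,q)$.
   Context: For $v \in \mathbb{R}^n$ let $\|v\|_T = \sum_{i=1}^n |v_i|$ (taxicab norm), and let $B_T^n = \{x \in \mathbb{R}^n : \|x\|_T < 1\}$. Curves: $\Gamma(p,q)$ is the set of maps $\gamma : [0,1] \to B_T^n$ all of whose components $\gamma_1,\dots,\gamma_n$ are absolutely continuous, with $\gamma(0)=p$ and $\gamma(1)=q$. A curve is fully monotonic if each component $\gamma_i$ is (weakly) monotonic (some components may be nondecreasing and others nonincreasing). The length of a curve $\gamma:[a,b]\to B_T^n$ with absolutely continuous components is $\mathcal{L}(\gamma) = \int_a^b \frac{\|\gamma'(t)\|_T}{1-\|\gamma(t)\|_T^2}\,dt$. Minimal point: for real $x,y$ let $\operatorname{sgn}(x) \in \{1,-1,0\}$ be the sign of $x$ (with $\operatorname{sgn}(0)=0$) and let $\ell(x,y) = \operatorname{sgn}(x)\min\{|x|,|y|\}$ if $\operatorname{sgn}(x)=\operatorname{sgn}(y)$, and $\ell(x,y)=0$ otherwise. For $p,q \in B_T^n$, $m(p,q) \in B_T^n$ is the point with coordinates $m_i(p,q) = \ell(p_i,q_i)$. L-shaped curve: with $\sigma_{x,y}(t) = x + t(y-x)$ for $t\in[0,1]$ and $m = m(p,q)$, $\lambda_{p,q}:[0,1]\to B_T^n$ is the concatenation of $\sigma_{p,m}$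 followed by $\sigma_{m,q}$, i.e. $\lambda_{p,q}(t) = \sigma_{p,m}(2t)$ for $0\le t\le \tfrac12$ and $\lambda_{p,q}(t)=\sigma_{m,q}(2t-1)$ for $\tfrac12 < t \le 1$. *)

theory Defs
  imports "HOL-Analysis.Analysis"
begin

definition taxi_norm :: "real ^ 'n \<Rightarrow> real"
  where "taxi_norm v = (\<Sum>i\<in>UNIV. \<bar>v $ i\<bar>)"

definition taxi_ball :: "(real ^ 'n) set"
  where "taxi_ball = {x. taxi_norm x < 1}"

(* The intervals in the family are indexed by {..<N}; degenerate ones contribute
   nothing to either sum. *)
definition absolutely_continuous_on :: "real \<Rightarrow> real \<Rightarrow> (real \<Rightarrow> real) \<Rightarrow> bool"
  where "absolutely_continuous_on a b f \<longleftrightarrow>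
    (\<forall>\<epsilon>>0. \<exists>\<delta>>0. \<forall>(N::nat) u v.
      (\<forall>k<N. a \<le> u k \<and> u k \<le> v k \<and> v k \<le> b) \<longrightarrow>
      disjoint_family_on (\<lambda>k. {u k<..<v k}) {..<N} \<longrightarrow>
      (\<Sum>k<N. v k - u k) < \<delta> \<longrightarrow>
      (\<Sum>k<N. \<bar>f (v k) - f (u k)\<bar>) < \<epsilon>)"

(* Curves on [0,1] are total functions whose values outside [0,1] are irrelevant:
   every notion below depends only on the restriction to [0,1]. *)
definition curves :: "real ^ 'n \<Rightarrow> real ^ 'n \<Rightarrow> (real \<Rightarrow> real ^ 'n) set"
  where "curves p q = {\<gamma>.
    (\<forall>t\<in>{0..1}. \<gamma> t \<in> taxi_ball) \<and>
    (\<forall>i. absolutely_continuous_on 0 1 (\<lambda>t. \<gamma> t $ i)) \<and>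
    \<gamma> 0 = p \<and> \<gamma> 1 = q}"

definition fully_monotonic :: "(real \<Rightarrow> real ^ 'n) \<Rightarrow> bool"
  where "fully_monotonic \<gamma> \<longleftrightarrow>
    (\<forall>i. mono_on {0..1} (\<lambda>t. \<gamma> t $ i) \<or> antimono_on {0..1} (\<lambda>t. \<gamma> t $ i))"

(* A curve with absolutely continuous components is differentiable almost everywhere,
   its derivative is Lebesgue integrable, and the weight is bounded on its compact image
   inside the open ball.  Hence the integral below exists and is finite, and the
   unspecified value of vector_derivative on the exceptional null set does not matter. *)
definition curve_length :: "real \<Rightarrow> real \<Rightarrow> (real \<Rightarrow> real ^ 'n) \<Rightarrow> real"
  where "curve_length a b \<gamma> =
    (LINT t:{a..b}|lebesgue.
      taxi_norm (vector_derivative \<gamma> (at t within {a..b})) / (1 - (taxi_norm (\<gamma> t))\<^sup>2))"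

definition ell :: "real \<Rightarrow> real \<Rightarrow> real"
  where "ell x y = (if sgn x = sgn y then sgn x * min \<bar>x\<bar> \<bar>y\<bar> else 0)"

definition minimal_point :: "real ^ 'n \<Rightarrow> real ^ 'n \<Rightarrow> real ^ 'n"
  where "minimal_point p q = (\<chi> i. ell (p $ i) (q $ i))"

definition L_curve :: "real ^ 'n \<Rightarrow> real ^ 'n \<Rightarrow> real \<Rightarrow> real ^ 'n"
  where "L_curve p q = linepath p (minimal_point p q) +++ linepath (minimal_point p q) q"

end

theory Submission
  imports Defs
begin

text \<open>
  Let \<open>A t\<close> be the taxicab variation of \<open>\<gamma>\<close> up to time \<open>t\<close>, \<open>S\<close> its total variation, \<open>r\<close> the norm
  of \<open>\<gamma>\<close>, \<open>P\<close> and \<open>Q\<close> the norms of the end points and \<open>M\<close> the norm of the minimal point. Then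
  \<open>r \<ge> P - A\<close> and \<open>r \<ge> Q - (S - A)\<close>, and coordinatewise \<open>S \<ge> P + Q - 2 M\<close>. Since the weight
  \<open>1 / (1 - r\<^sup>2)\<close> increases with \<open>r\<close> and has the antiderivative \<open>artanh\<close>, the part of \<open>\<gamma>\<close> before
  \<open>A\<close> reaches \<open>P - M\<close> has length at least \<open>artanh P - artanh M\<close>, the part after \<open>A\<close> reaches
  \<open>S - (Q - M)\<close> has length at least \<open>artanh Q - artanh M\<close>, and the part in between is free only if
  it is trivial. Equality therefore means \<open>S = P + Q - 2 M\<close>, i.e. full monotonicity, and that the
  norm \<open>M\<close> is attained, which for monotonic \<open>\<gamma>\<close> happens only at the minimal point.

  The curves are only absolutely continuous, so this needs the Lebesgue fundamental theorem of
  calculus. Differentiability almost everywhere follows from the Vitali covering theorem: if on a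
  set of positive measure the difference quotients oscillate across \<open>p < q\<close>, cover it by intervals of
  slope below \<open>p\<close>, and inside these by intervals of slope above \<open>q\<close>; the gaps between the latter have
  small total length, hence by absolute continuity small total increment, a contradiction.
\<close>

hide_const (open) Polynomial.content

section \<open>Absolute continuity and finite Vitali coverings\<close>

lemma division_interval_real:
  fixes D :: "real set set"
  assumes "D division_of S" "K \<in> D"
  obtains c d where "c \<le> d" "K = {c..d}" "Inf K = c" "Sup K = d" "content K = d - c" "K \<subseteq> S"
proof -
  obtain c d where K: "K = cbox c d" "K \<noteq> {}"
    using division_ofD(3,4)[OF assms] by blast
  then have "c \<le> d" by auto
  then show thesis
    using that[of c d] K division_ofD(2)[OF assms] by simp
qed

text \<open>Covering arguments and the gauge integral produce finite divisions, i.e. sets of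
  intervals, while the definition speaks of indexed families. Enumerating the division converts one
  into the other; \<open>Inf K\<close> and \<open>Sup K\<close> recover the end points.\<close>

lemma absolutely_continuous_on_division:
  assumes "absolutely_continuous_on a b f" "0 < e"
  obtains d where "0 < d"
    "\<And>D. D division_of \<Union>D \<Longrightarrow> \<Union>D \<subseteq> {a..b} \<Longrightarrow> sum content D < d \<Longrightarrow>
       (\<Sum>K\<in>D. \<bar>f (Sup K) - f (Inf K)\<bar>) < e"
proof -
  obtain d where "0 < d" and d: "\<And>(N::nat) u v. \<forall>k<N. a \<le> u k \<and> u k \<le> v k \<and> v k \<le> b \<Longrightarrow>
      disjoint_family_on (\<lambda>k. {u k<..<v k}) {..<N} \<Longrightarrow>
      (\<Sum>k<N. v k - u k) < d \<Longrightarrow> (\<Sum>k<N. \<bar>f (v k) - f (u k)\<bar>) < e"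
    using assms unfolding absolutely_continuous_on_def by meson
  show thesis
  proof
    fix D :: "real set set"
    assume D: "D division_of \<Union>D" and sub: "\<Union>D \<subseteq> {a..b}" and small: "sum content D < d"
    have "finite D" using D by auto
    then obtain h where h: "bij_betw h {..<card D} D"
      using ex_bij_betw_nat_finite atLeast0LessThan by metis
    have hD: "h k \<in> D" if "k < card D" for k
      using h that by (auto simp: bij_betw_def)
    have reindex: "(\<Sum>k<card D. \<phi> (h k)) = sum \<phi> D" for \<phi> :: "real set \<Rightarrow> real"
      using sum.reindex_bij_betw[OF h] by simp
    have 1: "\<forall>k<card D. a \<le> Inf (h k) \<and> Inf (h k) \<le> Sup (h k) \<and> Sup (h k) \<le> b"
    proof (intro allI impI)
      fix k assume "k < card D"
      from division_interval_real[OF D hD[OF this]] obtain c d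
        where "c \<le> d" "h k = {c..d}" "Inf (h k) = c" "Sup (h k) = d" "h k \<subseteq> \<Union>D" .
      moreover from this have "{c..d} \<subseteq> {a..b}"
        using sub by (metis order_trans)
      ultimately show "a \<le> Inf (h k) \<and> Inf (h k) \<le> Sup (h k) \<and> Sup (h k) \<le> b"
        by auto
    qed
    have int: "interior (h k) = {Inf (h k)<..<Sup (h k)}" if "k < card D" for k
      by (rule division_interval_real[OF D hD[OF that]]) (metis interior_atLeastAtMost_real)
    have 2: "disjoint_family_on (\<lambda>k. {Inf (h k)<..<Sup (h k)}) {..<card D}"
      unfolding disjoint_family_on_def
    proof (intro ballI impI)
      fix i j assume ij: "i \<in> {..<card D}" "j \<in> {..<card D}" "i \<noteq> j"
      then have "h i \<noteq> h j"
        using h by (auto simp: bij_betw_def inj_on_def)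
      then have "interior (h i) \<inter> interior (h j) = {}"
        using division_ofD(5)[OF D] ij hD by auto
      then show "{Inf (h i)<..<Sup (h i)} \<inter> {Inf (h j)<..<Sup (h j)} = {}"
        using int ij by simp
    qed
    have "(\<Sum>k<card D. Sup (h k) - Inf (h k)) = (\<Sum>k<card D. content (h k))"
    proof (rule sum.cong[OF refl])
      fix k assume "k \<in> {..<card D}"
      then show "Sup (h k) - Inf (h k) = content (h k)"
        using division_interval_real[OF D hD] by (metis lessThan_iff)
    qed
    then have 3: "(\<Sum>k<card D. Sup (h k) - Inf (h k)) < d"
      using small reindex by simp
    show "(\<Sum>K\<in>D. \<bar>f (Sup K) - f (Inf K)\<bar>) < e"
      using d[OF 1 2 3] reindex[of "\<lambda>K. \<bar>f (Sup K) - f (Inf K)\<bar>"] by simp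
  qed (fact \<open>0 < d\<close>)
qed

lemma sum_diff_division:
  fixes f :: "real \<Rightarrow> real"
  assumes D: "D division_of {a..b}" and "a \<le> b"
  shows "(\<Sum>K\<in>D. f (Sup K) - f (Inf K)) = f b - f a"
proof -
  \<comment> \<open>Tags are immaterial for the increments; left end points turn the division into a
    tagged one, for which telescoping is available.\<close>
  let ?p = "(\<lambda>K. (Inf K, K)) ` D"
  have "?p tagged_division_of {a..b}"
  proof (rule tagged_division_ofI)
    show "finite ?p" using D by auto
    fix x K assume "(x, K) \<in> ?p"
    then have x: "x = Inf K" and K: "K \<in> D" by auto
    obtain c d where "c \<le> d" "K = {c..d}" "Inf K = c" "K \<subseteq> {a..b}"
      using division_interval_real[OF D K] .
    then show "x \<in> K" "K \<subseteq> {a..b}" "\<exists>a b. K = cbox a b"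
      using x by auto
    fix y L assume "(y, L) \<in> ?p" "(x, K) \<noteq> (y, L)"
    then show "interior K \<inter> interior L = {}"
      using x K division_ofD(5)[OF D] by auto
  next
    show "\<Union> {K. \<exists>x. (x, K) \<in> ?p} = {a..b}"
      unfolding division_ofD(6)[OF D, symmetric] by blast
  qed
  from additive_tagged_division_1[OF \<open>a \<le> b\<close> this, of f] show ?thesis
    by (simp add: sum.reindex inj_on_def)
qed

lemma absolutely_continuous_on_subset:
  assumes "absolutely_continuous_on a b f" "a \<le> c" "d \<le> b"
  shows "absolutely_continuous_on c d f"
  unfolding absolutely_continuous_on_def
proof (intro allI impI)
  fix e :: real assume "0 < e"
  then obtain \<delta> where "\<delta> > 0" and \<delta>: "\<forall>(N::nat) u v. (\<forall>k<N. a \<le> u k \<and> u k \<le> v k \<and> v k \<le> b) \<longrightarrow>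
      disjoint_family_on (\<lambda>k. {u k<..<v k}) {..<N} \<longrightarrow>
      (\<Sum>k<N. v k - u k) < \<delta> \<longrightarrow> (\<Sum>k<N. \<bar>f (v k) - f (u k)\<bar>) < e"
    using assms(1) unfolding absolutely_continuous_on_def by meson
  have "(\<Sum>k<N. \<bar>f (v k) - f (u k)\<bar>) < e"
    if "\<forall>k<N. c \<le> u k \<and> u k \<le> v k \<and> v k \<le> d" "disjoint_family_on (\<lambda>k. {u k<..<v k}) {..<N}"
       "(\<Sum>k<N. v k - u k) < \<delta>" for N :: nat and u v
    using \<delta>[rule_format, of N u v] that assms(2,3) by force
  then show "\<exists>\<delta>>0. \<forall>(N::nat) u v. (\<forall>k<N. c \<le> u k \<and> u k \<le> v k \<and> v k \<le> d) \<longrightarrow>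
      disjoint_family_on (\<lambda>k. {u k<..<v k}) {..<N} \<longrightarrow>
      (\<Sum>k<N. v k - u k) < \<delta> \<longrightarrow> (\<Sum>k<N. \<bar>f (v k) - f (u k)\<bar>) < e"
    using \<open>\<delta> > 0\<close> by blast
qed

lemma absolutely_continuous_on_uniform:
  assumes "absolutely_continuous_on a b f" "0 < e"
  obtains d where "0 < d"
    "\<And>x y. x \<in> {a..b} \<Longrightarrow> y \<in> {a..b} \<Longrightarrow> \<bar>x - y\<bar> < d \<Longrightarrow> \<bar>f x - f y\<bar> < e"
proof -
  obtain d where "0 < d" and d: "\<And>D. D division_of \<Union>D \<Longrightarrow> \<Union>D \<subseteq> {a..b} \<Longrightarrow>
      sum content D < d \<Longrightarrow> (\<Sum>K\<in>D. \<bar>f (Sup K) - f (Inf K)\<bar>) < e"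
    by (rule absolutely_continuous_on_division[OF assms]) blast
  have *: "\<bar>f y - f x\<bar> < e" if "x \<le> y" "x \<in> {a..b}" "y \<in> {a..b}" "\<bar>x - y\<bar> < d" for x y
  proof -
    have "{{x..y}} division_of \<Union>{{x..y}}"
      using division_of_self[of x y] that by simp
    moreover have "\<Union>{{x..y}} \<subseteq> {a..b}"
      using that by auto
    ultimately show ?thesis
      using d[of "{{x..y}}"] that by simp
  qed
  show thesis
  proof
    fix x y assume "x \<in> {a..b}" "y \<in> {a..b}" "\<bar>x - y\<bar> < d"
    then show "\<bar>f x - f y\<bar> < e"
      using *[of x y] *[of y x] by (cases "x \<le> y") (auto simp: abs_minus_commute)
  qed (fact \<open>0 < d\<close>)
qed

lemma absolutely_continuous_on_imp_continuous_on:
  assumes "absolutely_continuous_on a b f"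
  shows "continuous_on {a..b} f"
  unfolding continuous_on_iff dist_real_def
proof (intro ballI allI impI)
  fix x e :: real assume "x \<in> {a..b}" "0 < e"
  moreover obtain d where "0 < d"
    "\<And>x y. x \<in> {a..b} \<Longrightarrow> y \<in> {a..b} \<Longrightarrow> \<bar>x - y\<bar> < d \<Longrightarrow> \<bar>f x - f y\<bar> < e"
    by (rule absolutely_continuous_on_uniform[OF assms \<open>0 < e\<close>]) blast
  ultimately show "\<exists>d>0. \<forall>x'\<in>{a..b}. \<bar>x' - x\<bar> < d \<longrightarrow> \<bar>f x' - f x\<bar> < e"
    by blast
qed

text \<open>Serves to tilt a function by the mean of two slopes, so that an upper and a lower slope
  bound become symmetric about 0.\<close>

lemma absolutely_continuous_on_minus_linear:
  assumes "absolutely_continuous_on a b f"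
  shows "absolutely_continuous_on a b (\<lambda>x. f x - c * x)"
  unfolding absolutely_continuous_on_def
proof (intro allI impI)
  fix e :: real assume "0 < e"
  then obtain \<delta> where "\<delta> > 0" and \<delta>: "\<forall>(N::nat) u v. (\<forall>k<N. a \<le> u k \<and> u k \<le> v k \<and> v k \<le> b) \<longrightarrow>
      disjoint_family_on (\<lambda>k. {u k<..<v k}) {..<N} \<longrightarrow>
      (\<Sum>k<N. v k - u k) < \<delta> \<longrightarrow> (\<Sum>k<N. \<bar>f (v k) - f (u k)\<bar>) < e / 2"
    using assms[unfolded absolutely_continuous_on_def, rule_format, of "e / 2"] by auto
  \<comment> \<open>The increments of \<open>f\<close> take half of \<open>e\<close>, the linear
    term the other half; the \<open>+ 1\<close> keeps the denominator positive when
    \<open>c = 0\<close>.\<close>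
  define \<eta> where "\<eta> = min \<delta> (e / (2 * (\<bar>c\<bar> + 1)))"
  have "\<eta> > 0" using \<open>\<delta> > 0\<close> \<open>0 < e\<close> by (simp add: \<eta>_def)
  have "(\<Sum>k<N. \<bar>f (v k) - c * v k - (f (u k) - c * u k)\<bar>) < e"
    if uv: "\<forall>k<N. a \<le> u k \<and> u k \<le> v k \<and> v k \<le> b" "disjoint_family_on (\<lambda>k. {u k<..<v k}) {..<N}"
       "(\<Sum>k<N. v k - u k) < \<eta>" for N :: nat and u v
  proof -
    have "(\<Sum>k<N. \<bar>f (v k) - c * v k - (f (u k) - c * u k)\<bar>)
        \<le> (\<Sum>k<N. \<bar>f (v k) - f (u k)\<bar> + \<bar>c\<bar> * (v k - u k))"
    proof (rule sum_mono)
      fix k assume "k \<in> {..<N}"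
      then have "\<bar>c * (v k - u k)\<bar> = \<bar>c\<bar> * (v k - u k)"
        using uv(1) by (simp add: abs_mult)
      then show "\<bar>f (v k) - c * v k - (f (u k) - c * u k)\<bar> \<le> \<bar>f (v k) - f (u k)\<bar> + \<bar>c\<bar> * (v k - u k)"
        by (simp add: right_diff_distrib)
    qed
    also have "\<dots> = (\<Sum>k<N. \<bar>f (v k) - f (u k)\<bar>) + \<bar>c\<bar> * (\<Sum>k<N. v k - u k)"
      by (simp add: sum.distrib sum_distrib_left)
    also have "(\<Sum>k<N. \<bar>f (v k) - f (u k)\<bar>) < e / 2"
      using \<delta> uv by (simp add: \<eta>_def)
    also have "\<bar>c\<bar> * (\<Sum>k<N. v k - u k) \<le> \<bar>c\<bar> * (e / (2 * (\<bar>c\<bar> + 1)))"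
      using uv(3) by (intro mult_left_mono) (auto simp: \<eta>_def)
    also have "\<dots> \<le> e / 2"
      using \<open>0 < e\<close> by (simp add: divide_simps mult_ac)
    finally show ?thesis by simp
  qed
  then show "\<exists>\<delta>>0. \<forall>(N::nat) u v. (\<forall>k<N. a \<le> u k \<and> u k \<le> v k \<and> v k \<le> b) \<longrightarrow>
      disjoint_family_on (\<lambda>k. {u k<..<v k}) {..<N} \<longrightarrow>
      (\<Sum>k<N. v k - u k) < \<delta> \<longrightarrow> (\<Sum>k<N. \<bar>f (v k) - c * v k - (f (u k) - c * u k)\<bar>) < e"
    using \<open>\<eta> > 0\<close> by blast
qed

section \<open>Finite disjoint families from Vitali coverings\<close>

text \<open>Vitali's theorem extracts from the fine cover a countable disjoint family covering
  almost all of \<open>S\<close>, and finitely many members capture all but \<open>e\<close> of its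
  measure. The bound on what their interiors miss allows a second covering to be nested inside the
  first.\<close>

lemma Vitali_finite_division:
  fixes S :: "real set"
  assumes S: "S \<in> lmeasurable" and G: "open G" "S \<subseteq> G" and "0 < e"
    and fine: "\<And>x d. x \<in> S \<Longrightarrow> 0 < d \<Longrightarrow> \<exists>u v. u < v \<and> x \<in> {u..v} \<and> v - u < d \<and> Q u v"
  obtains D where "D division_of \<Union>D" "\<Union>D \<subseteq> G"
    "\<And>K. K \<in> D \<Longrightarrow> \<exists>u v. u < v \<and> K = {u..v} \<and> Q u v"
    "measure lebesgue S - e < sum content D"
    "pairwise disjnt D" "measure lebesgue (S - \<Union>(interior ` D)) < e"
proof -
  \<comment> \<open>An interval is coded as the pair of its end points and read as a closed ball,
    the shape for which the covering theorem is stated.\<close>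
  let ?c = "\<lambda>i. (fst i + snd i) / 2 :: real" and ?r = "\<lambda>i. (snd i - fst i) / 2 :: real"
  let ?cb = "\<lambda>i. cball (?c i) (?r i)"
  define I where "I = {(u, v). u < v \<and> {u..v} \<subseteq> G \<and> Q u v}"
  have cb: "?cb (u, v) = {u..v}" for u v
    by (auto simp: cball_def dist_real_def field_simps abs_if)
  have 1: "\<exists>i. i \<in> I \<and> x \<in> ?cb i \<and> ?r i < d" if xd: "x \<in> S" "0 < d" for x d
  proof -
    obtain d' where "0 < d'" and d': "ball x d' \<subseteq> G"
      using G \<open>x \<in> S\<close> open_contains_ball by blast
    obtain u v where uv: "u < v" "x \<in> {u..v}" "v - u < min d d'" "Q u v"
      using fine[of x "min d d'"] xd \<open>0 < d'\<close> by (metis min_less_iff_conj)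
    have "{u..v} \<subseteq> ball x d'"
      using uv by (auto simp: dist_real_def)
    then have "(u, v) \<in> I"
      using uv d' by (auto simp: I_def)
    moreover have "?r (u, v) < d"
      using uv by simp
    ultimately show ?thesis
      using uv cb by blast
  qed
  have 2: "0 < ?r i" if "i \<in> I" for i
    using that by (auto simp: I_def)
  obtain C where C: "countable C" "C \<subseteq> I"
    and disj: "pairwise (\<lambda>i j. disjnt (?cb i) (?cb j)) C"
    and neg: "negligible (S - (\<Union>i\<in>C. ?cb i))"
    by (rule Vitali_covering_theorem_cballs[OF 2 1]) (assumption, assumption, assumption, blast)
  let ?D = "\<lambda>i. {fst i <..< snd i}"
  have CI: "fst i < snd i" "{fst i..snd i} \<subseteq> G" "Q (fst i) (snd i)" "?cb i = {fst i..snd i}" if "i \<in> C" for i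
  proof -
    have "i \<in> I" using that C by blast
    then show "fst i < snd i" "{fst i..snd i} \<subseteq> G" "Q (fst i) (snd i)"
      unfolding I_def by (simp_all add: split_beta)
    show "?cb i = {fst i..snd i}" using cb[of "fst i" "snd i"] by simp
  qed
  \<comment> \<open>Passing to open intervals loses only countably many end points, a null
    set.\<close>
  have neg': "negligible (S - (\<Union>i\<in>C. ?D i))"
  proof (rule negligible_subset)
    show "negligible ((S - (\<Union>i\<in>C. ?cb i)) \<union> (\<Union>i\<in>C. {fst i, snd i}))"
      using neg C(1) by (intro negligible_Un negligible_countable_Union) auto
    show "S - (\<Union>i\<in>C. ?D i) \<subseteq> (S - (\<Union>i\<in>C. ?cb i)) \<union> (\<Union>i\<in>C. {fst i, snd i})"
    proof
      fix x assume x: "x \<in> S - (\<Union>i\<in>C. ?D i)"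
      show "x \<in> (S - (\<Union>i\<in>C. ?cb i)) \<union> (\<Union>i\<in>C. {fst i, snd i})"
      proof (cases "x \<in> (\<Union>i\<in>C. ?cb i)")
        case True
        then obtain i where "i \<in> C" "x \<in> ?cb i" by blast
        then have "i \<in> C" "x \<in> {fst i..snd i}" using CI by auto
        moreover have "x \<notin> ?D i" using x \<open>i \<in> C\<close> by blast
        ultimately have "x = fst i \<or> x = snd i" by auto
        then show ?thesis using \<open>i \<in> C\<close> by blast
      qed (use x in blast)
    qed
  qed
  let ?M = "(\<lambda>i. S \<inter> ?D i) ` C"
  have meas: "S \<inter> ?D i \<in> lmeasurable" for i
    using S by (intro fmeasurable_Int_fmeasurable) auto
  have bound: "measure lebesgue (\<Union>D') \<le> measure lebesgue S" if "D' \<subseteq> ?M" "finite D'" for D'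
    using that S meas by (intro measure_mono_fmeasurable) (auto intro!: sets.finite_Union)
  \<comment> \<open>Continuity from below along the countable family: finitely many traces on
    \<open>S\<close> already have almost full measure.\<close>
  obtain M where M: "M \<subseteq> ?M" "finite M" "measure lebesgue (\<Union>?M) - e < measure lebesgue (\<Union>M)"
  proof (rule measure_countable_Union_approachable[OF _ \<open>0 < e\<close> _ bound])
    show "countable ?M" using C(1) by simp
    show "d \<in> lmeasurable" if "d \<in> ?M" for d using that meas by blast
  qed
  obtain F where F: "F \<subseteq> C" "finite F" "M = (\<lambda>i. S \<inter> ?D i) ` F"
    using finite_subset_image[OF M(2,1)] by blast
  have "measure lebesgue S = measure lebesgue (\<Union>?M)"
  proof (rule measure_negligible_symdiff[symmetric, OF S])
    have "sym_diff S (\<Union>?M) = S - (\<Union>i\<in>C. ?D i)" by auto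
    then show "negligible (sym_diff S (\<Union>?M))" using neg' by simp
  qed
  then have mS: "measure lebesgue S - e < measure lebesgue (S \<inter> (\<Union>i\<in>F. ?D i))"
  proof -
    have "S \<inter> (\<Union>i\<in>F. ?D i) = \<Union>M" unfolding F(3) by blast
    with M(3) show ?thesis by (simp only: \<open>measure lebesgue S = measure lebesgue (\<Union>?M)\<close>)
  qed
  define D where "D = (\<lambda>i. {fst i..snd i}) ` F"
  have finD: "finite D" using F by (simp add: D_def)
  have disjD: "K \<inter> L = {}" if KL: "K \<in> D" "L \<in> D" "K \<noteq> L" for K L
  proof -
    obtain i j where ij: "i \<in> F" "j \<in> F" "K = {fst i..snd i}" "L = {fst j..snd j}"
      using KL by (auto simp: D_def)
    then have "i \<noteq> j" using KL by auto
    then have "disjnt (?cb i) (?cb j)"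
      using disj ij F(1) by (meson pairwiseD subsetD)
    then show ?thesis
      using CI(4)[of i] CI(4)[of j] ij F(1) unfolding disjnt_def by (metis subsetD)
  qed
  have intD: "\<Union>(interior ` D) = (\<Union>i\<in>F. ?D i)"
    by (simp add: D_def)
  have lm: "S \<inter> (\<Union>i\<in>F. ?D i) \<in> lmeasurable"
    using S F(2) by (intro fmeasurable_Int_fmeasurable sets.finite_UN) auto
  show thesis
  proof
    show "D division_of \<Union>D"
    proof (rule division_ofI)
      fix K L assume "K \<in> D" "L \<in> D" "K \<noteq> L"
      then show "interior K \<inter> interior L = {}"
        using disjD interior_subset by fast
    next
      fix K assume "K \<in> D"
      then obtain i where "i \<in> F" "K = {fst i..snd i}" by (auto simp: D_def)
      then show "K \<noteq> {}" "\<exists>a b. K = cbox a b"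
        using CI(1)[of i] F(1) by force+
    qed (use finD in auto)
    show "\<Union>D \<subseteq> G" using CI(2) F(1) unfolding D_def by blast
    show "\<exists>u v. u < v \<and> K = {u..v} \<and> Q u v" if KD: "K \<in> D" for K
    proof -
      obtain i where "i \<in> F" "K = {fst i..snd i}" using KD unfolding D_def by blast
      then show ?thesis using CI(1,3) F(1) by blast
    qed
    have "measure lebesgue (S \<inter> (\<Union>i\<in>F. ?D i)) \<le> measure lebesgue (\<Union>D)"
      using lm finD
      by (intro measure_mono_fmeasurable) (auto simp: D_def F intro!: fmeasurable.finite_UN)
    also have "\<dots> = sum content D"
    proof (subst measure_negligible_finite_Union[OF finD])
      show "pairwise (\<lambda>S T. negligible (S \<inter> T)) D"
        using disjD by (auto simp: pairwise_def)
      show "K \<in> lmeasurable" if "K \<in> D" for K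
        using that by (auto simp: D_def)
      show "(\<Sum>K\<in>D. measure lebesgue K) = sum content D"
        by (rule sum.cong) (auto simp: D_def)
    qed
    finally show "measure lebesgue S - e < sum content D" using mS by simp
    show "pairwise disjnt D" using disjD by (auto simp: pairwise_def disjnt_def)
    have "measure lebesgue (S - \<Union>(interior ` D)) = measure lebesgue (S - (S \<inter> (\<Union>i\<in>F. ?D i)))"
      unfolding intD by (simp add: Diff_Int_distrib Diff_Int)
    also have "\<dots> = measure lebesgue S - measure lebesgue (S \<inter> (\<Union>i\<in>F. ?D i))"
      using S lm by (intro measurable_measure_Diff) auto
    finally show "measure lebesgue (S - \<Union>(interior ` D)) < e" using mS by simp
  qed
qed

section \<open>Null sets of oscillating or unbounded difference quotients\<close>

lemma division_imp_sum_content: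
  fixes D :: "real set set"
  assumes "D division_of S"
  shows "S \<in> lmeasurable" "sum content D = measure lebesgue S"
proof -
  show "S \<in> lmeasurable" using lmeasurable_division[OF assms] .
  have "sum content D = (\<Sum>K\<in>D. measure lebesgue K)"
  proof (rule sum.cong[OF refl])
    fix K assume "K \<in> D"
    then obtain c d where "K = cbox c d" using division_ofD(4)[OF assms] by blast
    then show "content K = measure lebesgue K" by simp
  qed
  then show "sum content D = measure lebesgue S"
    using content_division[OF assms] by simp
qed

text \<open>Tilted by the mean slope, \<open>f\<close> becomes \<open>h\<close>, with slopes below
  \<open>- k\<close> on the intervals of \<open>D1\<close> and above \<open>k\<close> on those of
  \<open>D2\<close> nested in them. When \<open>D2\<close> is completed to a division
  \<open>R\<close> of \<open>\<Union>D1\<close>, the total increment is at most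
  \<open>- k * (\<alpha> - e)\<close>, the share of \<open>D2\<close> is at least
  \<open>k * (\<alpha> - 2 * e)\<close>, and the remaining cells contribute less than
  \<open>k * \<alpha>\<close> in absolute value. For small \<open>e\<close> this is
  impossible.\<close>

lemma negligible_derivative_oscillation:
  fixes f :: "real \<Rightarrow> real"
  assumes ac: "absolutely_continuous_on a b f" and E: "E \<in> sets lebesgue" "E \<subseteq> {a<..<b}" and "p < q"
    and lo: "\<And>x d. x \<in> E \<Longrightarrow> 0 < d \<Longrightarrow>
      \<exists>u v. u < v \<and> x \<in> {u..v} \<and> v - u < d \<and> f v - f u < p * (v - u)"
    and hi: "\<And>x d. x \<in> E \<Longrightarrow> 0 < d \<Longrightarrow>
      \<exists>u v. u < v \<and> x \<in> {u..v} \<and> v - u < d \<and> q * (v - u) < f v - f u"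
  shows "negligible E"
proof (rule ccontr)
  assume nonneg: "\<not> negligible E"
  define h where "h = (\<lambda>x. f x - (p + q) / 2 * x)"
  define k where "k = (q - p) / 2"
  define \<alpha> where "\<alpha> = measure lebesgue E"
  have "k > 0" using \<open>p < q\<close> by (simp add: k_def)
  have Elm: "E \<in> lmeasurable"
    by (rule fmeasurableI2[OF lmeasurable_interval(2) E(2,1)])
  have "\<alpha> > 0"
    using nonneg negligible_iff_measure0[OF Elm] by (simp add: \<alpha>_def zero_less_measure_iff)
  have hac: "absolutely_continuous_on a b h"
    unfolding h_def by (rule absolutely_continuous_on_minus_linear[OF ac])
  have "0 < k * \<alpha>" using \<open>k > 0\<close> \<open>\<alpha> > 0\<close> by simp
  obtain \<delta> where "0 < \<delta>"
    and \<delta>: "\<And>D. D division_of \<Union>D \<Longrightarrow> \<Union>D \<subseteq> {a..b} \<Longrightarrow> sum content D < \<delta> \<Longrightarrow>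
       (\<Sum>K\<in>D. \<bar>h (Sup K) - h (Inf K)\<bar>) < k * \<alpha>"
    by (rule absolutely_continuous_on_division[OF hac \<open>0 < k * \<alpha>\<close>]) blast
  \<comment> \<open>\<open>3 * e\<close> will bound the length of the cells outside
    \<open>D2\<close> and must stay below \<open>\<delta>\<close>;
    \<open>4 * e \<le> \<alpha>\<close> makes the final inequality contradictory.\<close>
  define e where "e = min (\<delta> / 4) (\<alpha> / 4)"
  have e: "0 < e" "3 * e < \<delta>" "4 * e \<le> \<alpha>"
    using \<open>0 < \<delta>\<close> \<open>\<alpha> > 0\<close> by (auto simp: e_def)
  \<comment> \<open>The open superset exceeds \<open>E\<close> by less than \<open>e\<close>, so
    disjoint intervals chosen inside it have total length below \<open>\<alpha> + e\<close>.\<close>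
  obtain T where T: "open T" "E \<subseteq> T" "T - E \<in> lmeasurable" "emeasure lebesgue (T - E) < ennreal e"
    using sets_lebesgue_outer_open[OF E(1) \<open>0 < e\<close>] .
  define G where "G = T \<inter> {a<..<b}"
  have G: "open G" "E \<subseteq> G" "G \<subseteq> {a..b}"
    using T E by (auto simp: G_def)
  have Glm: "G \<in> lmeasurable"
    unfolding G_def Int_commute[of T]
    using T(1) by (intro fmeasurable_Int_fmeasurable) auto
  have "measure lebesgue (T - E) < e"
    using T(3,4) e(1) by (simp add: emeasure_eq_measure2 ennreal_less_iff)
  moreover have "measure lebesgue (G - E) \<le> measure lebesgue (T - E)"
    using Glm Elm T(3) by (intro measure_mono_fmeasurable) (auto simp: G_def)
  moreover have "measure lebesgue (G - E) = measure lebesgue G - \<alpha>"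
    unfolding \<alpha>_def using Glm Elm G(2) by (intro measurable_measure_Diff) auto
  ultimately have mG: "measure lebesgue G < \<alpha> + e" by linarith
  have hlo: "\<exists>u v. u < v \<and> x \<in> {u..v} \<and> v - u < d \<and> h v - h u < - k * (v - u)"
    if xd: "x \<in> E" "0 < d" for x d
  proof -
    obtain u v where uv: "u < v" "x \<in> {u..v}" "v - u < d" "f v - f u < p * (v - u)"
      using lo[OF xd] by blast
    then have "h v - h u < - k * (v - u)" by (simp add: h_def k_def field_simps)
    then show ?thesis using uv by blast
  qed
  have hhi: "\<exists>u v. u < v \<and> x \<in> {u..v} \<and> v - u < d \<and> k * (v - u) < h v - h u"
    if xd: "x \<in> E" "0 < d" for x d
  proof -
    obtain u v where uv: "u < v" "x \<in> {u..v}" "v - u < d" "q * (v - u) < f v - f u"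
      using hi[OF xd] by blast
    then have "k * (v - u) < h v - h u" by (simp add: h_def k_def field_simps)
    then show ?thesis using uv by blast
  qed
  obtain D1 where D1: "D1 division_of \<Union>D1" "\<Union>D1 \<subseteq> G"
    and D1lo: "\<And>K. K \<in> D1 \<Longrightarrow> \<exists>u v. u < v \<and> K = {u..v} \<and> h v - h u < - k * (v - u)"
    and D1m: "measure lebesgue E - e < sum content D1"
    and D1disj: "pairwise disjnt D1"
    and D1cov: "measure lebesgue (E - \<Union>(interior ` D1)) < e"
    by (rule Vitali_finite_division[OF Elm G(1,2) e(1) hlo]) (assumption, assumption, blast)
  \<comment> \<open>Only points interior to some member of \<open>D1\<close> are kept: around them,
    small steep intervals fit into a single member.\<close>
  define E1 where "E1 = E \<inter> \<Union>(interior ` D1)"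
  have E1op: "open (\<Union>(interior ` D1))" by blast
  have E1lm: "E1 \<in> lmeasurable"
    unfolding E1_def using E1op by (intro fmeasurable_Int_fmeasurable[OF Elm]) auto
  have "measure lebesgue (E - E1) = \<alpha> - measure lebesgue E1"
    unfolding \<alpha>_def by (intro measurable_measure_Diff) (use Elm E1lm in \<open>auto simp: E1_def\<close>)
  moreover have "E - E1 = E - \<Union>(interior ` D1)" by (auto simp: E1_def)
  ultimately have mE1: "\<alpha> - e < measure lebesgue E1" using D1cov by simp
  have fine2: "\<exists>u v. u < v \<and> x \<in> {u..v} \<and> v - u < d \<and> (k * (v - u) < h v - h u \<and> (\<exists>I\<in>D1. {u..v} \<subseteq> I))"
    if x: "x \<in> E1" and "0 < d" for x d
  proof -
    obtain I where I: "I \<in> D1" "x \<in> interior I" using x by (auto simp: E1_def)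
    then obtain r where "0 < r" "ball x r \<subseteq> I" by (auto simp: mem_interior)
    have "x \<in> E" using x by (auto simp: E1_def)
    from hhi[OF this, of "min d r"] obtain u v where uv: "u < v" "x \<in> {u..v}" "v - u < min d r" "k * (v - u) < h v - h u"
      using \<open>0 < d\<close> \<open>0 < r\<close> by auto
    have "{u..v} \<subseteq> ball x r" using uv by (auto simp: dist_real_def)
    then have "{u..v} \<subseteq> I" "v - u < d" using uv(3) \<open>ball x r \<subseteq> I\<close> by auto
    then show ?thesis using uv(1,2,4) I(1) by blast
  qed
  have E1G: "E1 \<subseteq> G" using G(2) by (auto simp: E1_def)
  obtain D2 where D2: "D2 division_of \<Union>D2"
    and D2hi: "\<And>K. K \<in> D2 \<Longrightarrow> \<exists>u v. u < v \<and> K = {u..v} \<and> (k * (v - u) < h v - h u \<and> (\<exists>I\<in>D1. {u..v} \<subseteq> I))"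
    and D2m: "measure lebesgue E1 - e < sum content D2"
    by (rule Vitali_finite_division[OF E1lm G(1) E1G e(1) fine2]) (assumption, assumption, blast)
  have fin: "finite D1" "finite D2" using D1 D2 by auto
  \<comment> \<open>Each member \<open>I\<close> of \<open>D1\<close> is divided so that the cells
    of \<open>D2\<close> inside it occur among the pieces; the other pieces are the gaps.\<close>
  have "\<exists>r. {K \<in> D2. K \<subseteq> I} \<subseteq> r \<and> r division_of I" if ID1: "I \<in> D1" for I
  proof -
    obtain c d where I: "I = cbox c d" using division_ofD(4)[OF D1(1) ID1] by blast
    have "{K \<in> D2. K \<subseteq> I} division_of \<Union>{K \<in> D2. K \<subseteq> I}"
      by (rule division_of_subset[OF D2]) auto
    then obtain r where "{K \<in> D2. K \<subseteq> I} \<subseteq> r" "r division_of cbox c d"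
      by (rule partial_division_extend_interval[of _ c d]) (use I in auto)
    then show ?thesis using I by blast
  qed
  then obtain r where rsub: "\<And>I. I \<in> D1 \<Longrightarrow> {K \<in> D2. K \<subseteq> I} \<subseteq> r I"
    and rdiv: "\<And>I. I \<in> D1 \<Longrightarrow> r I division_of I"
    by metis
  define R where "R = \<Union>(r ` D1)"
  have D2R: "D2 \<subseteq> R"
  proof
    fix K assume "K \<in> D2"
    then obtain I where "I \<in> D1" "K \<subseteq> I" using D2hi by blast
    then have "K \<in> r I" using rsub \<open>K \<in> D2\<close> by blast
    then show "K \<in> R" using \<open>I \<in> D1\<close> by (auto simp: R_def)
  qed
  \<comment> \<open>Members of \<open>D1\<close> are disjoint as sets, not merely without common
    interior, so a cell, even a degenerate one, belongs to the division of only one member.\<close>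
  have cross: "K \<inter> L = {}" if "I \<in> D1" "J \<in> D1" "I \<noteq> J" "K \<in> r I" "L \<in> r J" for I J K L
  proof -
    have "I \<inter> J = {}" using D1disj that(1,2,3) by (auto simp: pairwise_def disjnt_def)
    then show ?thesis
      using division_ofD(2)[OF rdiv[OF that(1)] that(4)] division_ofD(2)[OF rdiv[OF that(2)] that(5)] by blast
  qed
  have Rdiv: "R division_of \<Union>R"
    unfolding R_def
  proof (rule division_of_Union)
    show "p division_of \<Union>p" if "p \<in> r ` D1" for p
      using that rdiv by auto
    fix K L assume "K \<in> \<Union>(r ` D1)" "L \<in> \<Union>(r ` D1)" "K \<noteq> L"
    then obtain I J where IJ: "I \<in> D1" "J \<in> D1" "K \<in> r I" "L \<in> r J" by blast
    show "interior K \<inter> interior L = {}"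
    proof (cases "I = J")
      case True
      then show ?thesis using division_ofD(5)[OF rdiv[OF IJ(1)]] IJ \<open>K \<noteq> L\<close> by blast
    next
      case False
      then show ?thesis using cross[OF IJ(1,2)] IJ interior_subset by blast
    qed
  qed (use fin in auto)
  have UR: "\<Union>R = \<Union>D1"
    unfolding R_def using division_ofD(6)[OF rdiv] by blast
  have sumR: "sum \<phi> R = (\<Sum>I\<in>D1. sum \<phi> (r I))" for \<phi> :: "real set \<Rightarrow> real"
    unfolding R_def
  proof (rule sum.UNION_disjoint[OF fin(1)])
    show "\<forall>I\<in>D1. finite (r I)" using rdiv by blast
    show "\<forall>I\<in>D1. \<forall>J\<in>D1. I \<noteq> J \<longrightarrow> r I \<inter> r J = {}"
    proof (intro ballI impI equals0I)
      fix I J K assume IJ: "I \<in> D1" "J \<in> D1" "I \<noteq> J" and "K \<in> r I \<inter> r J"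
      then have "K \<inter> K = {}" using cross[OF IJ] by blast
      then show False using division_ofD(3)[OF rdiv[OF IJ(1)], of K] \<open>K \<in> r I \<inter> r J\<close> by simp
    qed
  qed
  let ?\<Delta> = "\<lambda>K. h (Sup K) - h (Inf K)"
  have "sum ?\<Delta> R = sum ?\<Delta> D1"
    unfolding sumR
  proof (rule sum.cong[OF refl])
    fix I assume "I \<in> D1"
    then obtain u v where "u < v" "I = {u..v}" using D1lo by blast
    then show "sum ?\<Delta> (r I) = ?\<Delta> I"
      using sum_diff_division[of "r I" u v h] rdiv[OF \<open>I \<in> D1\<close>] by simp
  qed
  also have "\<dots> \<le> (\<Sum>K\<in>D1. - k * content K)"
  proof (rule sum_mono)
    fix I assume "I \<in> D1"
    then obtain u v where "u < v" "I = {u..v}" "h v - h u < - k * (v - u)" using D1lo by blast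
    then show "?\<Delta> I \<le> - k * content I" by simp
  qed
  also have "\<dots> = - k * sum content D1" by (simp add: sum_distrib_left)
  also have "\<dots> \<le> - k * (\<alpha> - e)"
    using D1m \<open>k > 0\<close> by (simp add: \<alpha>_def)
  finally have up: "sum ?\<Delta> R \<le> - k * (\<alpha> - e)" .
  have "k * (\<alpha> - 2 * e) \<le> k * sum content D2"
    using D2m mE1 \<open>k > 0\<close> by simp
  also have "\<dots> = (\<Sum>K\<in>D2. k * content K)" by (simp add: sum_distrib_left)
  also have "\<dots> \<le> sum ?\<Delta> D2"
  proof (rule sum_mono)
    fix I assume "I \<in> D2"
    then obtain u v where "u < v" "I = {u..v}" "k * (v - u) < h v - h u" using D2hi by blast
    then show "k * content I \<le> ?\<Delta> I" by simp
  qed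
  finally have low: "k * (\<alpha> - 2 * e) \<le> sum ?\<Delta> D2" .
  have finR: "finite R" using Rdiv by auto
  have gap: "(R - D2) division_of \<Union>(R - D2)"
    by (rule division_of_subset[OF Rdiv]) auto
  have "sum content R = measure lebesgue (\<Union>D1)"
    using division_imp_sum_content(2)[OF Rdiv] UR by simp
  also have "\<dots> \<le> measure lebesgue G"
    using division_imp_sum_content(1)[OF D1(1)] D1(2) Glm by (intro measure_mono_fmeasurable) auto
  \<comment> \<open>Length balance: all of \<open>R\<close> has less than
    \<open>\<alpha> + e\<close>, while \<open>D2\<close> has more than
    \<open>\<alpha> - 2 * e\<close>.\<close>
  finally have "sum content (R - D2) < 3 * e"
    using mG D2m mE1 sum_diff[OF finR D2R, of content] by linarith
  moreover have "\<Union>(R - D2) \<subseteq> {a..b}"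
    using UR D1(2) G(3) by blast
  ultimately have "(\<Sum>K\<in>R - D2. \<bar>?\<Delta> K\<bar>) < k * \<alpha>"
    using \<delta>[OF gap] e(2) by linarith
  moreover have "\<bar>sum ?\<Delta> (R - D2)\<bar> \<le> (\<Sum>K\<in>R - D2. \<bar>?\<Delta> K\<bar>)" by (rule sum_abs)
  moreover have "sum ?\<Delta> (R - D2) = sum ?\<Delta> R - sum ?\<Delta> D2"
    using sum_diff[OF finR D2R] .
  ultimately have "k * (\<alpha> - 2 * e) - k * \<alpha> < - k * (\<alpha> - e)"
    using up low by linarith
  then have "k * (\<alpha> - 3 * e) < 0" by (simp add: algebra_simps)
  then show False using \<open>k > 0\<close> e \<open>\<alpha> > 0\<close> by (simp add: mult_less_0_iff)
qed

text \<open>On a portion of positive measure \<open>\<alpha>\<close>, disjoint intervals of slope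
  above \<open>2 / \<alpha>\<close> and total length above \<open>\<alpha> / 2\<close> would carry
  increments of total size above 1. Absolute continuity forbids this for total length below
  \<open>\<delta>\<close>, which is why the argument runs in a short window around each
  point.\<close>

lemma negligible_infinite_derivative:
  fixes f :: "real \<Rightarrow> real"
  assumes ac: "absolutely_continuous_on a b f" and E: "E \<in> sets lebesgue" "E \<subseteq> {a<..<b}"
    and steep: "\<And>x d c. x \<in> E \<Longrightarrow> 0 < d \<Longrightarrow>
      \<exists>u v. u < v \<and> x \<in> {u..v} \<and> v - u < d \<and> c * (v - u) < \<bar>f v - f u\<bar>"
  shows "negligible E"
proof -
  obtain \<delta> where "0 < \<delta>"
    and \<delta>: "\<And>D. D division_of \<Union>D \<Longrightarrow> \<Union>D \<subseteq> {a..b} \<Longrightarrow> sum content D < \<delta> \<Longrightarrow>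
       (\<Sum>K\<in>D. \<bar>f (Sup K) - f (Inf K)\<bar>) < 1"
    by (rule absolutely_continuous_on_division[OF ac zero_less_one]) blast
  show ?thesis
    unfolding locally_negligible_alt[of E]
  proof
    fix x assume "x \<in> E"
    \<comment> \<open>The window is shorter than \<open>\<delta>\<close>, so every disjoint family
      of intervals in it has total length below \<open>\<delta>\<close>.\<close>
    define G where "G = {x - \<delta> / 3<..<x + \<delta> / 3} \<inter> {a<..<b}"
    define S where "S = E \<inter> G"
    have G: "open G" "S \<subseteq> G" by (auto simp: G_def S_def)
    have "x \<in> S" using \<open>x \<in> E\<close> \<open>0 < \<delta>\<close> E by (auto simp: S_def G_def)
    have "openin (top_of_set E) S"
      unfolding S_def using G(1) by (rule openin_open_Int)
    moreover have "negligible S"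
    proof (rule ccontr)
      assume "\<not> negligible S"
      have Ssub: "S \<subseteq> {a<..<b}" by (auto simp: S_def G_def)
      have Ss: "S \<in> sets lebesgue" unfolding S_def using E(1) G(1) by auto
      have Slm: "S \<in> lmeasurable"
        by (rule fmeasurableI2[OF lmeasurable_interval(2) Ssub Ss])
      define \<alpha> where "\<alpha> = measure lebesgue S"
      have "\<alpha> > 0"
        using \<open>\<not> negligible S\<close> negligible_iff_measure0[OF Slm] by (simp add: \<alpha>_def zero_less_measure_iff)
      then have a2: "0 < \<alpha> / 2" by simp
      have fine: "\<exists>u v. u < v \<and> x \<in> {u..v} \<and> v - u < d \<and> 2 / \<alpha> * (v - u) < \<bar>f v - f u\<bar>"
        if "x \<in> S" "0 < d" for x d
        using steep[of x d "2 / \<alpha>"] that by (auto simp: S_def)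
      obtain D where D: "D division_of \<Union>D" "\<Union>D \<subseteq> G"
        and Dst: "\<And>K. K \<in> D \<Longrightarrow> \<exists>u v. u < v \<and> K = {u..v} \<and> 2 / \<alpha> * (v - u) < \<bar>f v - f u\<bar>"
        and Dm: "measure lebesgue S - \<alpha> / 2 < sum content D"
        by (rule Vitali_finite_division[OF Slm G a2 fine]) (assumption, assumption, blast)
      have "sum content D \<le> content (cbox (x - \<delta> / 3) (x + \<delta> / 3))"
        by (rule subadditive_content_division[OF D(1)]) (use D(2) in \<open>auto simp: G_def\<close>)
      then have "sum content D < \<delta>" using \<open>0 < \<delta>\<close> by simp
      moreover have "\<Union>D \<subseteq> {a..b}" using D(2) by (auto simp: G_def)
      ultimately have "(\<Sum>K\<in>D. \<bar>f (Sup K) - f (Inf K)\<bar>) < 1"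
        using \<delta>[OF D(1)] by simp
      moreover have "2 / \<alpha> * sum content D \<le> (\<Sum>K\<in>D. \<bar>f (Sup K) - f (Inf K)\<bar>)"
        unfolding sum_distrib_left
      proof (rule sum_mono)
        fix K assume "K \<in> D"
        then obtain u v where "u < v" "K = {u..v}" "2 / \<alpha> * (v - u) < \<bar>f v - f u\<bar>" using Dst by blast
        then show "2 / \<alpha> * content K \<le> \<bar>f (Sup K) - f (Inf K)\<bar>" by simp
      qed
      ultimately have "2 / \<alpha> * sum content D < 1" by linarith
      then have "sum content D < \<alpha> / 2" using \<open>\<alpha> > 0\<close> by (simp add: field_simps)
      then show False using Dm by (simp add: \<alpha>_def)
    qed
    ultimately show "\<exists>U. openin (top_of_set E) U \<and> x \<in> U \<and> negligible U"
      using \<open>x \<in> S\<close> by blast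
  qed
qed

section \<open>Differentiability almost everywhere\<close>

text \<open>A substitute for conditions on upper and lower derivatives: half-lines as
  \<open>W\<close> express that the quotients drop below or rise above a level arbitrarily near
  \<open>x\<close>. Stated without limits, the condition is easily seen to be Borel for open
  \<open>W\<close>.\<close>

definition slope_cluster :: "real \<Rightarrow> real \<Rightarrow> (real \<Rightarrow> real) \<Rightarrow> real set \<Rightarrow> real set"
  where "slope_cluster a b f W =
    {x\<in>{a<..<b}. \<exists>\<^sub>F y in at x. (f y - f x) / (y - x) \<in> W}"

lemma slope_clusterD:
  assumes "x \<in> slope_cluster a b f W" "0 < d"
  shows "\<exists>y\<in>{a<..<b}. y \<noteq> x \<and> \<bar>y - x\<bar> < d \<and> (f y - f x) / (y - x) \<in> W"
proof -
  have x: "x \<in> {a<..<b}" and fr: "\<exists>\<^sub>F y in at x. (f y - f x) / (y - x) \<in> W"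
    using assms by (auto simp: slope_cluster_def)
  have "\<forall>\<^sub>F y in at x. y \<in> {a<..<b} \<and> y \<in> ball x d \<and> y \<noteq> x"
    using x \<open>0 < d\<close> by (intro eventually_conj eventually_at_in_open' eventually_neq_at_within) auto
  from frequently_eventually_frequently[OF fr this] show ?thesis
    by (auto simp: dist_real_def abs_minus_commute dest!: frequently_ex)
qed

lemma slope_clusterI:
  assumes "x \<in> {a<..<b}"
    and "\<And>d. 0 < d \<Longrightarrow> \<exists>y. y \<noteq> x \<and> \<bar>y - x\<bar> < d \<and> (f y - f x) / (y - x) \<in> W"
  shows "x \<in> slope_cluster a b f W"
  using assms unfolding slope_cluster_def frequently_def eventually_at
  by (auto simp: dist_real_def)

text \<open>The set is a G-delta. For a fixed second point \<open>y\<close> the quotient is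
  continuous in the base point \<open>x\<close>, so each \<open>U n\<close> is open as a union,
  however uncountable, over \<open>y\<close>; the radii \<open>1 / real (Suc n)\<close> give a
  countable intersection.\<close>

lemma slope_cluster_borel:
  assumes cont: "continuous_on {a<..<b} f" and "open W"
  shows "slope_cluster a b f W \<in> sets borel"
proof -
  define U where "U n = (\<Union>y\<in>{a<..<b}. {x \<in> {a<..<b} \<inter> ball y (1 / real (Suc n)) - {y}. (f y - f x) / (y - x) \<in> W})" for n :: nat
  have "open (U n)" for n
    unfolding U_def
  proof (intro open_UN ballI)
    fix y assume "y \<in> {a<..<b}"
    let ?S = "{a<..<b} \<inter> ball y (1 / real (Suc n)) - {y}"
    have "continuous_on ?S (\<lambda>x. (f y - f x) / (y - x))"
      by (intro continuous_intros continuous_on_subset[OF cont]) auto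
    then have "open (?S \<inter> (\<lambda>x. (f y - f x) / (y - x)) -` W)"
      by (rule continuous_open_preimage) (intro open_Diff open_Int open_greaterThanLessThan open_ball closed_singleton \<open>open W\<close>)+
    moreover have "?S \<inter> (\<lambda>x. (f y - f x) / (y - x)) -` W = {x \<in> ?S. (f y - f x) / (y - x) \<in> W}"
      by auto
    ultimately show "open {x \<in> ?S. (f y - f x) / (y - x) \<in> W}" by simp
  qed
  moreover have "slope_cluster a b f W = (\<Inter>n. U n)"
  proof (intro equalityI subsetI INT_I)
    fix x n assume x: "x \<in> slope_cluster a b f W"
    have "0 < 1 / real (Suc n)" by simp
    from slope_clusterD[OF x this] obtain y where y: "y \<in> {a<..<b}" "y \<noteq> x"
      "\<bar>y - x\<bar> < 1 / real (Suc n)" "(f y - f x) / (y - x) \<in> W" by blast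
    have "x \<in> {a<..<b}" using x by (simp add: slope_cluster_def)
    then have "x \<in> {x \<in> {a<..<b} \<inter> ball y (1 / real (Suc n)) - {y}. (f y - f x) / (y - x) \<in> W}"
      using y by (simp add: dist_real_def)
    then show "x \<in> U n" unfolding U_def using y(1) by blast
  next
    fix x assume x: "x \<in> (\<Inter>n. U n)"
    show "x \<in> slope_cluster a b f W"
    proof (rule slope_clusterI)
      have "x \<in> U 0" using x by blast
      then show "x \<in> {a<..<b}" by (auto simp: U_def)
      fix d :: real assume "0 < d"
      then obtain n where n: "1 / real (Suc n) < d"
        using nat_approx_posE by blast
      have "x \<in> U n" using x by blast
      then obtain y where "x \<in> ball y (1 / real (Suc n))" "x \<noteq> y" "(f y - f x) / (y - x) \<in> W"
        by (auto simp: U_def)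
      then show "\<exists>y. y \<noteq> x \<and> \<bar>y - x\<bar> < d \<and> (f y - f x) / (y - x) \<in> W"
        using n by (intro exI[of _ y]) (auto simp: dist_real_def)
    qed
  qed
  ultimately show ?thesis by auto
qed

text \<open>The quotient is symmetric in its two points, so \<open>x\<close> and a nearby
  \<open>y\<close> serve as end points in either order.\<close>

lemma slope_cluster_interval:
  assumes "x \<in> slope_cluster a b f W" "0 < d"
  obtains u v where "u < v" "x \<in> {u..v}" "v - u < d" "(f v - f u) / (v - u) \<in> W"
proof -
  obtain y where y: "y \<noteq> x" "\<bar>y - x\<bar> < d" "(f y - f x) / (y - x) \<in> W"
    using slope_clusterD[OF assms] by blast
  show thesis
  proof (cases "x < y")
    case True
    then show ?thesis using that[of x y] y by auto
  next
    case False
    then have "y < x" using y by auto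
    moreover have "(f x - f y) / (x - y) = (f y - f x) / (y - x)"
      by (metis minus_diff_eq minus_divide_divide)
    ultimately show ?thesis using that[of y x] y by auto
  qed
qed

text \<open>If the lower limit of the quotients were below the upper limit, two rationals strictly
  between them would witness oscillation. So the limit exists in the extended reals, and the bound
  by some \<open>n\<close> makes it finite.\<close>

lemma differentiable_if_no_slope_cluster:
  fixes f :: "real \<Rightarrow> real"
  assumes x: "x \<in> {a<..<b}"
    and osc: "\<And>p q :: rat. p < q \<Longrightarrow>
      x \<notin> slope_cluster a b f {..<of_rat p} \<inter> slope_cluster a b f {of_rat q<..}"
    and inf: "x \<notin> (\<Inter>n::nat. slope_cluster a b f ({..<- real n} \<union> {real n<..}))"
  shows "\<exists>D. (f has_real_derivative D) (at x)"
proof -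
  define Q where "Q = (\<lambda>y. (f y - f x) / (y - x))"
  let ?l = "Liminf (at x) (\<lambda>y. ereal (Q y))" and ?L = "Limsup (at x) (\<lambda>y. ereal (Q y))"
  have cl: "x \<in> slope_cluster a b f W \<longleftrightarrow> (\<exists>\<^sub>F y in at x. Q y \<in> W)" for W
    using x by (simp add: slope_cluster_def Q_def)
  have "?L \<le> ?l"
  proof (rule ccontr)
    assume "\<not> ?L \<le> ?l"
    then have "?l < ?L" by simp
    then obtain p :: rat where p: "?l < real_of_rat p" "real_of_rat p < ?L" using ereal_dense3 by blast
    from ereal_dense3[OF p(2)] obtain q :: rat where q: "ereal (real_of_rat p) < real_of_rat q" "real_of_rat q < ?L" by blast
    have "\<exists>\<^sub>F y in at x. Q y \<in> {..<real_of_rat p}"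
    proof (rule ccontr)
      assume "\<not> ?thesis"
      then have "\<forall>\<^sub>F y in at x. ereal (real_of_rat p) \<le> ereal (Q y)"
        by (simp add: not_frequently not_less)
      from Liminf_bounded[OF this] show False using p(1) by simp
    qed
    moreover have "\<exists>\<^sub>F y in at x. Q y \<in> {real_of_rat q<..}"
    proof (rule ccontr)
      assume "\<not> ?thesis"
      then have "\<forall>\<^sub>F y in at x. ereal (Q y) \<le> ereal (real_of_rat q)"
        by (simp add: not_frequently not_less)
      from Limsup_bounded[OF this] show False using q(2) by simp
    qed
    moreover have "p < q" using q(1) by (simp add: of_rat_less)
    ultimately show False using osc[OF \<open>p < q\<close>] cl by blast
  qed
  then have "?l = ?L" by (intro antisym Liminf_le_Limsup) auto
  then have lim: "((\<lambda>y. ereal (Q y)) \<longlongrightarrow> ?l) (at x)" by (intro Liminf_eq_Limsup) auto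
  obtain n :: nat where "x \<notin> slope_cluster a b f ({..<- real n} \<union> {real n<..})" using inf by blast
  then have ev: "\<forall>\<^sub>F y in at x. - real n \<le> Q y \<and> Q y \<le> real n"
    by (simp add: cl not_frequently not_less)
  have "?l \<noteq> \<infinity>"
  proof
    assume "?l = \<infinity>"
    with lim have "\<forall>\<^sub>F y in at x. ereal (real n) < ereal (Q y)" by (simp add: tendsto_PInfty)
    with ev have "\<forall>\<^sub>F y in at x. False" by eventually_elim auto
    then show False by simp
  qed
  moreover have "?l \<noteq> - \<infinity>"
  proof
    assume "?l = - \<infinity>"
    with lim have "\<forall>\<^sub>F y in at x. ereal (Q y) < ereal (- real n)" by (simp add: tendsto_MInfty)
    with ev have "\<forall>\<^sub>F y in at x. False" by eventually_elim auto
    then show False by simp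
  qed
  ultimately obtain D where "?l = ereal D" by (cases ?l) auto
  then have "(Q \<longlongrightarrow> D) (at x)" using lim by simp
  then show ?thesis unfolding has_field_derivative_iff Q_def by blast
qed

text \<open>The exceptional set consists of the oscillation sets of the countably many pairs of
  rationals and of the points with unbounded quotients.\<close>

theorem absolutely_continuous_on_imp_differentiable_ae:
  assumes ac: "absolutely_continuous_on a b f"
  obtains N where "negligible N" "\<And>x. x \<in> {a<..<b} - N \<Longrightarrow> \<exists>D. (f has_real_derivative D) (at x)"
proof
  let ?O = "\<lambda>(p::rat, q::rat). slope_cluster a b f {..<of_rat p} \<inter> slope_cluster a b f {of_rat q<..}"
  let ?I = "\<Inter>n::nat. slope_cluster a b f ({..<- real n} \<union> {real n<..})"
  let ?N = "(\<Union>pq\<in>{(p, q). p < q}. ?O pq) \<union> ?I"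
  have cont: "continuous_on {a<..<b} f"
    using absolutely_continuous_on_imp_continuous_on[OF ac] continuous_on_subset greaterThanLessThan_subseteq_atLeastAtMost_iff
    by (metis order_refl)
  have sub: "slope_cluster a b f W \<subseteq> {a<..<b}" for W by (auto simp: slope_cluster_def)
  have "negligible (?O (p, q))" if "p < q" for p q
  proof (rule negligible_derivative_oscillation[OF ac])
    show "?O (p, q) \<in> sets lebesgue"
      using slope_cluster_borel[OF cont] by auto
    show "?O (p, q) \<subseteq> {a<..<b}" using sub by auto
    show "real_of_rat p < real_of_rat q" using that by (simp add: of_rat_less)
    fix x d :: real assume x: "x \<in> ?O (p, q)" and "0 < d"
    show "\<exists>u v. u < v \<and> x \<in> {u..v} \<and> v - u < d \<and> f v - f u < real_of_rat p * (v - u)"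
    proof -
      have "x \<in> slope_cluster a b f {..<of_rat p}" using x by simp
      from slope_cluster_interval[OF this \<open>0 < d\<close>] obtain u v where
        "u < v" "x \<in> {u..v}" "v - u < d" "(f v - f u) / (v - u) \<in> {..<real_of_rat p}" .
      then show ?thesis by (intro exI[of _ u] exI[of _ v]) (simp add: divide_less_eq)
    qed
    show "\<exists>u v. u < v \<and> x \<in> {u..v} \<and> v - u < d \<and> real_of_rat q * (v - u) < f v - f u"
    proof -
      have "x \<in> slope_cluster a b f {of_rat q<..}" using x by simp
      from slope_cluster_interval[OF this \<open>0 < d\<close>] obtain u v where
        "u < v" "x \<in> {u..v}" "v - u < d" "(f v - f u) / (v - u) \<in> {real_of_rat q<..}" .
      then show ?thesis by (intro exI[of _ u] exI[of _ v]) (simp add: less_divide_eq)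
    qed
  qed
  then have "negligible (\<Union>pq\<in>{(p, q). p < q}. ?O pq)"
    by (intro negligible_countable_Union) (auto intro: countableI_type)
  moreover have "negligible ?I"
  proof (rule negligible_infinite_derivative[OF ac])
    show "?I \<in> sets lebesgue"
    proof (rule sets_completionI_sets)
      show "?I \<in> sets lborel"
        using slope_cluster_borel[OF cont open_Un[OF open_lessThan open_greaterThan]] by (auto intro!: sets.countable_INT')
    qed
    show "?I \<subseteq> {a<..<b}" using sub by blast
    fix x d c :: real assume x: "x \<in> ?I" and "0 < d"
    obtain n :: nat where "c \<le> real n" using real_arch_simple[of c] by auto
    have "x \<in> slope_cluster a b f ({..<- real n} \<union> {real n<..})" using x by blast
    from slope_cluster_interval[OF this \<open>0 < d\<close>] obtain u v where
      uv: "u < v" "x \<in> {u..v}" "v - u < d" "(f v - f u) / (v - u) \<in> {..<- real n} \<union> {real n<..}" .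
    have "(f v - f u) / (v - u) < - real n \<or> real n < (f v - f u) / (v - u)"
      using uv(4) by (simp only: Un_iff lessThan_iff greaterThan_iff)
    then have "real n < \<bar>(f v - f u) / (v - u)\<bar>" by linarith
    then have "real n * (v - u) < \<bar>f v - f u\<bar>" using uv(1) by (simp add: less_divide_eq)
    moreover have "c * (v - u) \<le> real n * (v - u)" using \<open>c \<le> real n\<close> uv(1) by (intro mult_right_mono) auto
    ultimately have "c * (v - u) < \<bar>f v - f u\<bar>" by linarith
    then show "\<exists>u v. u < v \<and> x \<in> {u..v} \<and> v - u < d \<and> c * (v - u) < \<bar>f v - f u\<bar>"
      using uv(1-3) by blast
  qed
  ultimately show "negligible ?N" by (rule negligible_Un)
  fix x assume "x \<in> {a<..<b} - ?N"
  then show "\<exists>D. (f has_real_derivative D) (at x)"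
    by (intro differentiable_if_no_slope_cluster[of x a b]) auto
qed

section \<open>The fundamental theorem of calculus\<close>

text \<open>Cells tagged off the null set obey the linear approximation of \<open>f\<close> by its
  derivative. Cells tagged in it lie in an open set of measure below \<open>\<delta>\<close>, where
  absolute continuity bounds the sum of the increments. Gauge integrability of \<open>g\<close>
  results from the same estimate.\<close>

lemma absolutely_continuous_on_has_integral_derivative:
  fixes f g :: "real \<Rightarrow> real"
  assumes ac: "absolutely_continuous_on a b f" and "a \<le> b" and "negligible N"
    and der: "\<And>x. x \<in> {a<..<b} - N \<Longrightarrow> (f has_real_derivative g x) (at x)"
  shows "(g has_integral f b - f a) {a..b}"
proof -
  define M where "M = N \<union> {a, b}"
  \<comment> \<open>With value 0 on the bad set, cells tagged there contribute only increments of
    \<open>f\<close>. The end points belong to it because the derivative is given only in the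
    interior.\<close>
  define g0 where "g0 = (\<lambda>x. if x \<in> M then 0 else g x)"
  have M: "negligible M" unfolding M_def using \<open>negligible N\<close> by (intro negligible_Un) auto
  have "(g0 has_integral f b - f a) {a..b}"
    unfolding has_integral_real
  proof (intro allI impI)
    fix e :: real assume "0 < e"
    then have e2: "0 < e / 2" by simp
    obtain \<delta> where "0 < \<delta>"
      and \<delta>: "\<And>D. D division_of \<Union>D \<Longrightarrow> \<Union>D \<subseteq> {a..b} \<Longrightarrow> sum content D < \<delta> \<Longrightarrow>
         (\<Sum>K\<in>D. \<bar>f (Sup K) - f (Inf K)\<bar>) < e / 2"
      by (rule absolutely_continuous_on_division[OF ac e2]) blast
    obtain T where T: "open T" "M \<subseteq> T" "T - M \<in> lmeasurable" "emeasure lebesgue (T - M) < ennreal \<delta>"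
      using sets_lebesgue_outer_open[OF negligible_imp_sets[OF M] \<open>0 < \<delta>\<close>] .
    have Tlm: "T \<in> lmeasurable"
      by (rule fmeasurable_Diff_D[OF T(3) negligible_imp_measurable[OF M] T(2)])
    have "measure lebesgue T = measure lebesgue (T - M)"
    proof (rule measure_negligible_symdiff[OF T(3)])
      have "sym_diff (T - M) T \<subseteq> M" by auto
      then show "negligible (sym_diff (T - M) T)" using M negligible_subset by blast
    qed
    then have Tm: "measure lebesgue T < \<delta>"
      using T(3,4) \<open>0 < \<delta>\<close> by (simp add: emeasure_eq_measure2 ennreal_less_iff)
    define \<eta> where "\<eta> = e / (2 * (b - a + 1))"
    have "0 < \<eta>" using \<open>0 < e\<close> \<open>a \<le> b\<close> by (simp add: \<eta>_def)
    have "\<exists>S. open S \<and> x \<in> S \<and> (x \<in> M \<longrightarrow> S \<subseteq> T) \<and>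
        (x \<in> {a..b} - M \<longrightarrow> (\<forall>y\<in>S. \<bar>f y - f x - g0 x * (y - x)\<bar> \<le> \<eta> * \<bar>y - x\<bar>))" for x
    proof (cases "x \<in> {a..b} - M")
      case True
      then have "x \<in> {a<..<b} - N" by (auto simp: M_def)
      then have "(f has_derivative (\<lambda>h. g x * h)) (at x within UNIV)"
        using der by (simp add: has_field_derivative_def)
      then obtain d where "0 < d" and d: "\<And>y. norm (y - x) < d \<Longrightarrow>
          norm (f y - f x - g x * (y - x)) \<le> \<eta> * norm (y - x)"
        unfolding has_derivative_within_alt using \<open>0 < \<eta>\<close> by blast
      have "\<forall>y\<in>ball x d. \<bar>f y - f x - g0 x * (y - x)\<bar> \<le> \<eta> * \<bar>y - x\<bar>"
        using d True by (auto simp: dist_real_def abs_minus_commute g0_def)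
      then show ?thesis
        using \<open>0 < d\<close> True by (intro exI[of _ "ball x d"]) auto
    next
      case False
      then show ?thesis
        using T(1,2) by (intro exI[of _ "if x \<in> M then T else UNIV"]) auto
    qed
    then obtain \<gamma> where \<gamma>: "\<And>x. open (\<gamma> x)" "\<And>x. x \<in> \<gamma> x" "\<And>x. x \<in> M \<Longrightarrow> \<gamma> x \<subseteq> T"
      "\<And>x y. x \<in> {a..b} - M \<Longrightarrow> y \<in> \<gamma> x \<Longrightarrow> \<bar>f y - f x - g0 x * (y - x)\<bar> \<le> \<eta> * \<bar>y - x\<bar>"
      by metis
    show "\<exists>\<gamma>. gauge \<gamma> \<and> (\<forall>\<D>. \<D> tagged_division_of {a..b} \<and> \<gamma> fine \<D> \<longrightarrow>
        norm ((\<Sum>(x, K)\<in>\<D>. content K *\<^sub>R g0 x) - (f b - f a)) < e)"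
    proof (intro exI[of _ \<gamma>] conjI allI impI)
      show "gauge \<gamma>" using \<gamma>(1,2) by (simp add: gauge_def)
      fix p assume "p tagged_division_of {a..b} \<and> \<gamma> fine p"
      then have p: "p tagged_division_of {a..b}" and fine: "\<gamma> fine p" by auto
      have finp: "finite p" using p by auto
      define p1 where "p1 = {(x, K) \<in> p. x \<in> M}"
      define p2 where "p2 = {(x, K) \<in> p. x \<notin> M}"
      have p12: "p = p1 \<union> p2" "p1 \<inter> p2 = {}" "p1 \<subseteq> p" "p2 \<subseteq> p" "finite p1" "finite p2"
        using finp by (auto simp: p1_def p2_def elim: finite_subset[rotated])
      let ?\<Delta> = "\<lambda>K. f (Sup K) - f (Inf K)"
      have "(\<Sum>(x, K)\<in>p. content K *\<^sub>R g0 x) - (f b - f a) = (\<Sum>(x, K)\<in>p. content K * g0 x - ?\<Delta> K)"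
        using additive_tagged_division_1[OF \<open>a \<le> b\<close> p, of f] by (simp add: sum_subtractf split_def)
      also have "\<dots> = (\<Sum>(x, K)\<in>p1. content K * g0 x - ?\<Delta> K) + (\<Sum>(x, K)\<in>p2. content K * g0 x - ?\<Delta> K)"
        using p12 by (simp add: sum.union_disjoint)
      finally have split: "(\<Sum>(x, K)\<in>p. content K *\<^sub>R g0 x) - (f b - f a)
          = (\<Sum>(x, K)\<in>p1. content K * g0 x - ?\<Delta> K) + (\<Sum>(x, K)\<in>p2. content K * g0 x - ?\<Delta> K)" .
      have p1div: "p1 tagged_division_of \<Union>(snd ` p1)"
        using tagged_partial_division_of_Union_self tagged_partial_division_subset[OF _ p12(3)] p
        by (metis tagged_division_of_def)
      \<comment> \<open>\<open>Sup\<close> and \<open>Inf\<close> of the empty set are unspecified,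
        whereas passing from tagged cells to cells asks for the value 0 on every degenerate box,
        including the empty one.\<close>
      define \<phi> where "\<phi> = (\<lambda>K. if K = {} then 0 else \<bar>?\<Delta> K\<bar>)"
      have nonempty: "K \<noteq> {}" if "(x, K) \<in> p" for x K
        using tagged_division_ofD(2)[OF p that] by auto
      have "\<bar>\<Sum>(x, K)\<in>p1. content K * g0 x - ?\<Delta> K\<bar> \<le> (\<Sum>(x, K)\<in>p1. \<phi> K)"
        by (rule order_trans[OF sum_abs sum_mono]) (auto simp: p1_def g0_def \<phi>_def dest: nonempty)
      also have "(\<Sum>(x, K)\<in>p1. \<phi> K) = (\<Sum>K\<in>snd ` p1. \<phi> K)"
      proof (rule sum.over_tagged_division_lemma[OF p1div])
        fix u v :: real assume "box u v = {}"
        then have "v \<le> u" by simp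
        then show "\<phi> (cbox u v) = 0" by (cases "u = v") (auto simp: \<phi>_def)
      qed
      also have "\<dots> = (\<Sum>K\<in>snd ` p1. \<bar>?\<Delta> K\<bar>)"
        by (rule sum.cong) (use p12(3) nonempty in \<open>auto simp: \<phi>_def\<close>)
      also have "\<dots> < e / 2"
      proof (rule \<delta>)
        have div: "snd ` p1 division_of \<Union>(snd ` p1)"
          by (rule division_of_tagged_division[OF p1div])
        then show "snd ` p1 division_of \<Union>(snd ` p1)" .
        show "\<Union>(snd ` p1) \<subseteq> {a..b}"
          using tagged_division_ofD(3)[OF p] p12(3) by fastforce
        have "\<Union>(snd ` p1) \<subseteq> T"
          using fine \<gamma>(3) by (fastforce simp: p1_def fine_def)
        then have "measure lebesgue (\<Union>(snd ` p1)) \<le> measure lebesgue T"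
          using Tlm division_imp_sum_content(1)[OF div] by (intro measure_mono_fmeasurable) auto
        then show "sum content (snd ` p1) < \<delta>"
          using Tm division_imp_sum_content(2)[OF div] by simp
      qed
      finally have 1: "\<bar>\<Sum>(x, K)\<in>p1. content K * g0 x - ?\<Delta> K\<bar> < e / 2" .
      have "\<bar>\<Sum>(x, K)\<in>p2. content K * g0 x - ?\<Delta> K\<bar> \<le> (\<Sum>(x, K)\<in>p2. \<eta> * content K)"
      proof (rule order_trans[OF sum_abs sum_mono])
        fix z assume "z \<in> p2"
        then obtain x K where z: "z = (x, K)" "(x, K) \<in> p" "x \<notin> M" by (auto simp: p2_def)
        obtain u v where K: "K = cbox u v" using tagged_division_ofD(4)[OF p z(2)] by blast
        have "x \<in> K" "K \<subseteq> {a..b}" using tagged_division_ofD(2,3)[OF p z(2)] by auto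
        then have uv: "u \<le> x" "x \<le> v" "x \<in> {a..b} - M" using K z by auto
        have "K \<subseteq> \<gamma> x" using fine z(2) by (auto simp: fine_def)
        then have "u \<in> \<gamma> x" "v \<in> \<gamma> x" using K uv by auto
        \<comment> \<open>The approximation at the tag is applied at both ends of the cell; the two
          errors add up to \<open>\<eta>\<close> times its length.\<close>
        from \<gamma>(4)[OF uv(3) this(1)] \<gamma>(4)[OF uv(3) this(2)]
        have "\<bar>f u - f x - g0 x * (u - x)\<bar> \<le> \<eta> * (x - u)" "\<bar>f v - f x - g0 x * (v - x)\<bar> \<le> \<eta> * (v - x)"
          using uv by auto
        then have "\<bar>(v - u) * g0 x - (f v - f u)\<bar> \<le> \<eta> * (v - u)"
          by (simp add: abs_le_iff algebra_simps)
        then show "\<bar>case z of (x, K) \<Rightarrow> content K * g0 x - ?\<Delta> K\<bar> \<le> (case z of (x, K) \<Rightarrow> \<eta> * content K)"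
          using z K uv by simp
      qed
      also have "\<dots> \<le> (\<Sum>(x, K)\<in>p. \<eta> * content K)"
        using p12 finp \<open>0 < \<eta>\<close> by (intro sum_mono2) auto
      also have "\<dots> = \<eta> * (\<Sum>(x, K)\<in>p. content K)"
        by (simp add: sum_distrib_left split_def)
      also have "(\<Sum>(x, K)\<in>p. content K) = b - a"
        using additive_content_tagged_division[of p a b] p \<open>a \<le> b\<close> by simp
      also have "\<eta> * (b - a) \<le> e / 2"
        using \<open>0 < e\<close> \<open>a \<le> b\<close> by (simp add: \<eta>_def divide_simps mult_le_cancel_left_pos)
      finally show "norm ((\<Sum>(x, K)\<in>p. content K *\<^sub>R g0 x) - (f b - f a)) < e"
        using 1 unfolding split real_norm_def by linarith
    qed
  qed
  then show ?thesis
    by (rule has_integral_spike[OF M, rotated]) (simp add: g0_def)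
qed

text \<open>On a stretch shorter than \<open>\<delta>\<close> the integrals of \<open>g\<close> over
  cells are increments of \<open>f\<close> whose moduli sum to less than 1, and bounded variation of
  the integral gives absolute integrability. Finitely many such stretches make up
  \<open>{a..b}\<close>.\<close>

lemma absolutely_continuous_on_derivative_absolutely_integrable:
  fixes f g :: "real \<Rightarrow> real"
  assumes ac: "absolutely_continuous_on a b f" and "a \<le> b"
    and g: "\<And>c d. a \<le> c \<Longrightarrow> c \<le> d \<Longrightarrow> d \<le> b \<Longrightarrow> (g has_integral f d - f c) {c..d}"
  shows "g absolutely_integrable_on {a..b}"
proof -
  obtain \<delta> where "0 < \<delta>"
    and \<delta>: "\<And>D. D division_of \<Union>D \<Longrightarrow> \<Union>D \<subseteq> {a..b} \<Longrightarrow> sum content D < \<delta> \<Longrightarrow>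
       (\<Sum>K\<in>D. \<bar>f (Sup K) - f (Inf K)\<bar>) < 1"
    by (rule absolutely_continuous_on_division[OF ac zero_less_one]) blast
  have small: "g absolutely_integrable_on {c..d}" if cd: "a \<le> c" "c \<le> d" "d \<le> b" "d - c < \<delta>" for c d
  proof -
    have "g absolutely_integrable_on cbox c d"
    proof (rule bounded_variation_absolutely_integrable_interval)
      show "g integrable_on cbox c d" using g[OF cd(1-3)] by auto
      fix D assume D: "D division_of cbox c d"
      have "(\<Sum>K\<in>D. norm (integral K g)) = (\<Sum>K\<in>D. \<bar>f (Sup K) - f (Inf K)\<bar>)"
      proof (rule sum.cong[OF refl])
        fix K assume "K \<in> D"
        from division_interval_real[OF D this] obtain u v
          where uv: "u \<le> v" "K = {u..v}" "K \<subseteq> cbox c d" by metis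
        then have "(g has_integral f v - f u) {u..v}" using cd by (intro g) auto
        then show "norm (integral K g) = \<bar>f (Sup K) - f (Inf K)\<bar>"
          using uv by (simp add: integral_unique)
      qed
      also have "\<dots> < 1"
      proof (rule \<delta>)
        show "D division_of \<Union>D" using D by (rule division_of_union_self)
        show "\<Union>D \<subseteq> {a..b}" using division_ofD(6)[OF D] cd by auto
        show "sum content D < \<delta>" using additive_content_division[OF D] cd by simp
      qed
      finally show "(\<Sum>K\<in>D. norm (integral K g)) \<le> 1" by simp
    qed
    then show ?thesis by simp
  qed
  obtain n :: nat where n: "(b - a) / \<delta> < real n" using reals_Archimedean2 by blast
  have "0 < real n" using n \<open>0 < \<delta>\<close> \<open>a \<le> b\<close> by (meson divide_nonneg_pos diff_ge_0_iff_ge le_less_trans)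
  define s where "s = (b - a) / real n"
  have s: "0 \<le> s" "s < \<delta>" "real n * s = b - a"
    using n \<open>0 < \<delta>\<close> \<open>a \<le> b\<close> \<open>0 < real n\<close> by (auto simp: s_def divide_simps mult.commute)
  have "g absolutely_integrable_on {a..a + real k * s}" if "k \<le> n" for k
    using that
  proof (induction k)
    case 0
    then show ?case by (simp add: absolutely_integrable_negligible)
  next
    case (Suc k)
    have "real (Suc k) * s \<le> real n * s" using Suc.prems s(1) by (intro mult_right_mono) auto
    then have le: "a + real (Suc k) * s \<le> b" using s(3) by simp
    have "g absolutely_integrable_on {a + real k * s..a + real (Suc k) * s}"
      using le s by (intro small) (auto simp: algebra_simps)
    moreover have "g absolutely_integrable_on {a..a + real k * s}" using Suc by simp
    moreover have "{a..a + real (Suc k) * s} = {a..a + real k * s} \<union> {a + real k * s..a + real (Suc k) * s}"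
      using s(1) by (intro ivl_disj_un_two_touch(4)[symmetric]) (auto simp: algebra_simps)
    ultimately show ?case using absolutely_integrable_Un by metis
  qed
  from this[of n] show ?thesis using s(3) by simp
qed

theorem absolutely_continuous_on_fundamental_theorem:
  fixes f :: "real \<Rightarrow> real"
  assumes ac: "absolutely_continuous_on a b f" and "a \<le> b"
  obtains g N where "negligible N" "g absolutely_integrable_on {a..b}"
    "\<And>x. x \<in> {a<..<b} - N \<Longrightarrow> (f has_real_derivative g x) (at x)"
    "\<And>c d. a \<le> c \<Longrightarrow> c \<le> d \<Longrightarrow> d \<le> b \<Longrightarrow> (g has_integral f d - f c) {c..d}"
proof -
  obtain N where N: "negligible N" "\<And>x. x \<in> {a<..<b} - N \<Longrightarrow> \<exists>D. (f has_real_derivative D) (at x)"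
    by (rule absolutely_continuous_on_imp_differentiable_ae[OF ac]) blast
  then obtain g where g: "\<And>x. x \<in> {a<..<b} - N \<Longrightarrow> (f has_real_derivative g x) (at x)"
    by metis
  have int: "(g has_integral f d - f c) {c..d}" if "a \<le> c" "c \<le> d" "d \<le> b" for c d
  proof (rule absolutely_continuous_on_has_integral_derivative[OF _ that(2) N(1)])
    show "absolutely_continuous_on c d f"
      by (rule absolutely_continuous_on_subset[OF ac that(1,3)])
    show "(f has_real_derivative g x) (at x)" if "x \<in> {c<..<d} - N" for x
      using that \<open>a \<le> c\<close> \<open>d \<le> b\<close> by (intro g) auto
  qed
  have "g absolutely_integrable_on {a..b}"
    by (rule absolutely_continuous_on_derivative_absolutely_integrable[OF ac \<open>a \<le> b\<close> int])
  then show thesis using that N(1) g int by blast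
qed

section \<open>Integrals against a speed\<close>

text \<open>The analogue of a vanishing derivative with respect to \<open>A\<close>: on an equal
  partition of small mesh the increments of both functions telescope, so
  \<open>\<bar>F b - F a\<bar> \<le> e * (A b - A a)\<close> for every positive
  \<open>e\<close>.\<close>

lemma eq_endpoints_if_small_increments:
  fixes F A :: "real \<Rightarrow> real"
  assumes "a \<le> b"
    and small: "\<And>e. 0 < e \<Longrightarrow> \<exists>d>0. \<forall>u v. a \<le> u \<and> u \<le> v \<and> v \<le> b \<and> v - u < d \<longrightarrow>
      \<bar>F v - F u\<bar> \<le> e * (A v - A u)"
  shows "F b = F a"
proof -
  have bound: "\<bar>F b - F a\<bar> \<le> e * (A b - A a)" if "0 < e" for e
  proof -
    obtain d where "0 < d" and d: "\<And>u v. a \<le> u \<Longrightarrow> u \<le> v \<Longrightarrow> v \<le> b \<Longrightarrow> v - u < d \<Longrightarrow>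
      \<bar>F v - F u\<bar> \<le> e * (A v - A u)"
      using small[OF \<open>0 < e\<close>] by blast
    obtain n :: nat where n: "(b - a) / d < real n" using reals_Archimedean2 by blast
    have "0 < real n" using n \<open>0 < d\<close> \<open>a \<le> b\<close> by (meson divide_nonneg_pos diff_ge_0_iff_ge le_less_trans)
    define s where "s = (b - a) / real n"
    have s: "0 \<le> s" "s < d" "real n * s = b - a"
      using n \<open>0 < d\<close> \<open>a \<le> b\<close> \<open>0 < real n\<close> by (auto simp: s_def divide_simps mult.commute)
    define x where "x k = a + real k * s" for k :: nat
    have step: "\<bar>F (x (Suc k)) - F (x k)\<bar> \<le> e * (A (x (Suc k)) - A (x k))" if "k < n" for k
    proof (rule d)
      have "real (Suc k) * s \<le> real n * s" using that s(1) by (intro mult_right_mono) auto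
      then show "x (Suc k) \<le> b" using s(3) by (simp add: x_def)
      show "a \<le> x k" using s(1) by (simp add: x_def)
      show "x k \<le> x (Suc k)" "x (Suc k) - x k < d" using s by (auto simp: x_def algebra_simps)
    qed
    have ends: "x n = b" "x 0 = a" using s(3) by (auto simp: x_def)
    have telescope: "(\<Sum>k<n. G (x (Suc k)) - G (x k)) = G b - G a" for G :: "real \<Rightarrow> real"
      unfolding sum_lessThan_telescope[of "\<lambda>k. G (x k)"] ends ..
    have "\<bar>F b - F a\<bar> = \<bar>\<Sum>k<n. F (x (Suc k)) - F (x k)\<bar>"
      unfolding telescope ..
    also have "\<dots> \<le> (\<Sum>k<n. e * (A (x (Suc k)) - A (x k)))"
      by (rule order_trans[OF sum_abs sum_mono]) (use step in auto)
    also have "\<dots> = e * (A b - A a)"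
      unfolding sum_distrib_left[symmetric] telescope ..
    finally show ?thesis .
  qed
  show ?thesis
  proof (rule ccontr)
    assume "F b \<noteq> F a"
    then have pos: "0 < \<bar>F b - F a\<bar>" by simp
    define c where "c = \<bar>A b - A a\<bar> + 1"
    have "0 < c" by (simp add: c_def)
    have "0 < \<bar>F b - F a\<bar> / (2 * c)" using pos \<open>0 < c\<close> by simp
    from bound[OF this] have "\<bar>F b - F a\<bar> \<le> \<bar>F b - F a\<bar> / (2 * c) * (A b - A a)" .
    also have "\<dots> \<le> \<bar>F b - F a\<bar> / (2 * c) * c"
      using \<open>0 < c\<close> by (intro mult_left_mono) (auto simp: c_def)
    also have "\<dots> = \<bar>F b - F a\<bar> / 2" using \<open>0 < c\<close> by simp
    finally show False using pos by simp
  qed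
qed

text \<open>\<open>s\<close> stands for a speed and \<open>A\<close> for the distance travelled,
  fixed up to an additive constant.\<close>

locale integrated_speed =
  fixes a b :: real and s A :: "real \<Rightarrow> real"
  assumes ab: "a \<le> b"
    and s_abs: "s absolutely_integrable_on {a..b}"
    and s_nonneg: "\<And>t. t \<in> {a..b} \<Longrightarrow> 0 \<le> s t"
    and A: "\<And>c d. a \<le> c \<Longrightarrow> c \<le> d \<Longrightarrow> d \<le> b \<Longrightarrow> (s has_integral A d - A c) {c..d}"
begin

lemma A_mono: "a \<le> c \<Longrightarrow> c \<le> d \<Longrightarrow> d \<le> b \<Longrightarrow> A c \<le> A d"
  using has_integral_nonneg[OF A[of c d]] s_nonneg by simp

lemma A_continuous: "continuous_on {a..b} A"
proof -
  have "continuous_on {a..b} (\<lambda>t. A a + integral {a..t} s)"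
    using A[of a b] ab by (intro continuous_intros indefinite_integral_continuous_1) auto
  then show ?thesis
  proof (rule continuous_on_eq)
    fix t assume "t \<in> {a..b}"
    then show "A a + integral {a..t} s = A t"
      using integral_unique[OF A[of a t]] by simp
  qed
qed

lemma integrable_weight:
  assumes "continuous_on {a..b} \<psi>"
  shows "(\<lambda>t. \<psi> t * s t) absolutely_integrable_on {a..b}"
proof (rule absolutely_integrable_bounded_measurable_product_real[OF _ _ _ s_abs])
  show "\<psi> \<in> borel_measurable (lebesgue_on {a..b})"
    using assms by (intro continuous_imp_measurable_on_sets_lebesgue) auto
  show "bounded (\<psi> ` {a..b})"
    using assms by (intro compact_imp_bounded compact_continuous_image) auto
qed auto

lemma integrable_weight_sub:
  assumes "continuous_on {a..b} \<psi>" "a \<le> c" "d \<le> b"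
  shows "(\<lambda>t. \<psi> t * s t) integrable_on {c..d}"
proof (rule integrable_on_subinterval)
  show "(\<lambda>t. \<psi> t * s t) integrable_on {a..b}"
    by (rule set_lebesgue_integral_eq_integral(1)[OF integrable_weight[OF assms(1)]])
  show "{c..d} \<subseteq> {a..b}" using assms(2,3) by simp
qed

lemma weight_le_integral:
  assumes "continuous_on {a..b} \<psi>" "a \<le> c" "c \<le> d" "d \<le> b"
    and k: "\<And>t. t \<in> {c..d} \<Longrightarrow> k \<le> \<psi> t"
  shows "k * (A d - A c) \<le> integral {c..d} (\<lambda>t. \<psi> t * s t)"
proof (rule has_integral_le)
  show "((\<lambda>t. k * s t) has_integral k * (A d - A c)) {c..d}"
    using A assms by (intro has_integral_mult_right) auto
  show "((\<lambda>t. \<psi> t * s t) has_integral integral {c..d} (\<lambda>t. \<psi> t * s t)) {c..d}"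
    using integrable_weight_sub assms by blast
  show "k * s t \<le> \<psi> t * s t" if "t \<in> {c..d}" for t
    using k[OF that] s_nonneg[of t] that assms by (intro mult_right_mono) auto
qed

lemma weight_abs_integral:
  assumes "continuous_on {a..b} \<psi>" "a \<le> c" "c \<le> d" "d \<le> b"
    and k: "\<And>t. t \<in> {c..d} \<Longrightarrow> \<bar>\<psi> t\<bar> \<le> k"
  shows "\<bar>integral {c..d} (\<lambda>t. \<psi> t * s t)\<bar> \<le> k * (A d - A c)"
proof -
  have "- k \<le> \<psi> t" "- k \<le> - \<psi> t" if "t \<in> {c..d}" for t
    using k[OF that] by auto
  then have "- k * (A d - A c) \<le> integral {c..d} (\<lambda>t. \<psi> t * s t)"
    "- k * (A d - A c) \<le> integral {c..d} (\<lambda>t. - \<psi> t * s t)"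
    by (intro weight_le_integral continuous_on_minus assms; blast)+
  then show ?thesis by (simp add: abs_le_iff)
qed

text \<open>Substitution \<open>y = A t\<close> where \<open>A\<close> may fail to be differentiable
  or injective. On a short interval the mean value theorem writes the increment of
  \<open>\<Phi>\<close> as \<open>\<phi> y\<close> times that of \<open>A\<close>, the intermediate
  value theorem makes \<open>y\<close> a value of \<open>A\<close> there, and uniform continuity
  bounds the discrepancy with the integral.\<close>

lemma integral_substitution:
  assumes cd: "a \<le> c" "c \<le> d" "d \<le> b" and "A ` {c..d} \<subseteq> {\<alpha>..\<beta>}"
    and \<phi>: "continuous_on {\<alpha>..\<beta>} \<phi>"
    and \<Phi>: "\<And>y. y \<in> {\<alpha>..\<beta>} \<Longrightarrow> (\<Phi> has_real_derivative \<phi> y) (at y within {\<alpha>..\<beta>})"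
  shows "integral {c..d} (\<lambda>t. \<phi> (A t) * s t) = \<Phi> (A d) - \<Phi> (A c)"
proof -
  interpret cd: integrated_speed c d s A
  proof
    show "s absolutely_integrable_on {c..d}"
      by (rule set_integrable_subset[OF s_abs]) (use cd in auto)
  qed (use cd s_nonneg A in auto)
  have cont: "continuous_on {c..d} (\<lambda>t. \<phi> (A t))"
    by (rule continuous_on_compose2[OF \<phi> cd.A_continuous assms(4)])
  \<comment> \<open>The two sides differ by the increment of \<open>F\<close>, which vanishes by the
    criterion on small increments.\<close>
  define F where "F t = integral {c..t} (\<lambda>t. \<phi> (A t) * s t) - \<Phi> (A t)" for t
  have "F d = F c"
  proof (rule eq_endpoints_if_small_increments[OF cd(2)])
    fix e :: real assume "0 < e"
    have "uniformly_continuous_on {c..d} (\<lambda>t. \<phi> (A t))"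
      using cont by (intro compact_uniformly_continuous) auto
    then obtain \<delta> where "0 < \<delta>" and \<delta>: "\<And>t t'. t \<in> {c..d} \<Longrightarrow> t' \<in> {c..d} \<Longrightarrow> \<bar>t - t'\<bar> < \<delta> \<Longrightarrow>
        \<bar>\<phi> (A t) - \<phi> (A t')\<bar> < e"
      unfolding uniformly_continuous_on_def dist_real_def using \<open>0 < e\<close> by blast
    have "\<bar>F v - F u\<bar> \<le> e * (A v - A u)" if uv: "c \<le> u" "u \<le> v" "v \<le> d" "v - u < \<delta>" for u v
    proof -
      have Auv: "A u \<le> A v" using cd.A_mono uv by auto
      have sub: "{A u..A v} \<subseteq> {\<alpha>..\<beta>}"
        using assms(4) uv by (auto simp: image_subset_iff)
      obtain y where y: "A u \<le> y" "y \<le> A v" "\<Phi> (A v) - \<Phi> (A u) = \<phi> y * (A v - A u)"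
      proof (cases "A u = A v")
        case True
        then show ?thesis using that[of "A u"] by simp
      next
        case False
        then have lt: "A u < A v" using Auv by simp
        have "\<exists>y\<in>{A u<..<A v}. \<Phi> (A v) - \<Phi> (A u) = (A v - A u) * \<phi> y"
        proof (rule mvt_simple[OF lt, of \<Phi> "\<lambda>y h. h * \<phi> y", simplified])
          fix y assume "A u \<le> y" "y \<le> A v"
          then have "(\<Phi> has_real_derivative \<phi> y) (at y within {A u..A v})"
            using sub by (intro DERIV_subset[OF \<Phi> sub]) auto
          then show "(\<Phi> has_derivative (\<lambda>h. h * \<phi> y)) (at y within {A u..A v})"
            by (simp add: has_field_derivative_def mult_commute_abs)
        qed
        then obtain y where "A u < y" "y < A v" "\<Phi> (A v) - \<Phi> (A u) = (A v - A u) * \<phi> y" by auto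
        then show ?thesis using that[of y] by (simp add: mult.commute)
      qed
      obtain t' where t': "u \<le> t'" "t' \<le> v" "A t' = y"
        using IVT'[of A u y v] y uv continuous_on_subset[OF cd.A_continuous, of "{u..v}"] by auto
      have int: "(\<lambda>t. \<phi> (A t) * s t) integrable_on {c..v}" "(\<lambda>t. \<phi> (A t) * s t) integrable_on {u..v}"
        using cd.integrable_weight_sub[OF cont] uv by auto
      have "integral {c..v} (\<lambda>t. \<phi> (A t) * s t) =
          integral {c..u} (\<lambda>t. \<phi> (A t) * s t) + integral {u..v} (\<lambda>t. \<phi> (A t) * s t)"
        by (rule Henstock_Kurzweil_Integration.integral_combine[symmetric]) (use uv int in auto)
      then have "F v - F u = integral {u..v} (\<lambda>t. \<phi> (A t) * s t) - \<phi> y * (A v - A u)"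
        using y(3) by (simp add: F_def)
      also have "\<dots> = integral {u..v} (\<lambda>t. (\<phi> (A t) - \<phi> y) * s t)"
      proof -
        have "((\<lambda>t. \<phi> (A t) * s t - \<phi> y * s t) has_integral
            integral {u..v} (\<lambda>t. \<phi> (A t) * s t) - \<phi> y * (A v - A u)) {u..v}"
          using int(2) cd.A[of u v] uv by (intro has_integral_diff has_integral_mult_right) auto
        then show ?thesis by (simp add: left_diff_distrib integral_unique)
      qed
      also have "\<bar>\<dots>\<bar> \<le> e * (A v - A u)"
      proof (rule cd.weight_abs_integral)
        show "continuous_on {c..d} (\<lambda>t. \<phi> (A t) - \<phi> y)" using cont by (intro continuous_intros)
        fix t assume "t \<in> {u..v}"
        then show "\<bar>\<phi> (A t) - \<phi> y\<bar> \<le> e"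
          using \<delta>[of t t'] t' uv by force
      qed (use uv in auto)
      finally show ?thesis .
    qed
    then show "\<exists>\<delta>>0. \<forall>u v. c \<le> u \<and> u \<le> v \<and> v \<le> d \<and> v - u < \<delta> \<longrightarrow> \<bar>F v - F u\<bar> \<le> e * (A v - A u)"
      using \<open>0 < \<delta>\<close> by blast
  qed
  then show ?thesis by (simp add: F_def)
qed

end

section \<open>Radial lower bounds for the length\<close>

text \<open>Reduces the geometry to one dimension: \<open>r\<close> will be the norm along the
  curve, and the triangle inequality enters only as \<open>r_lipschitz\<close>.\<close>

locale radial_path = integrated_speed +
  fixes r :: "real \<Rightarrow> real"
  assumes r_range: "\<And>t. t \<in> {a..b} \<Longrightarrow> 0 \<le> r t \<and> r t < 1"
    and r_lipschitz: "\<And>u v. a \<le> u \<Longrightarrow> u \<le> v \<Longrightarrow> v \<le> b \<Longrightarrow> \<bar>r v - r u\<bar> \<le> A v - A u"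
begin

lemma r_continuous: "continuous_on {a..b} r"
  unfolding continuous_on_iff
proof (intro ballI allI impI)
  fix x e :: real assume x: "x \<in> {a..b}" and "0 < e"
  then obtain d where "0 < d" and d: "\<And>y. y \<in> {a..b} \<Longrightarrow> dist y x < d \<Longrightarrow> dist (A y) (A x) < e"
    using A_continuous unfolding continuous_on_iff by blast
  have "dist (r y) (r x) < e" if y: "y \<in> {a..b}" "dist y x < d" for y
  proof (cases "x \<le> y")
    case True
    then show ?thesis using d[OF y] r_lipschitz[of x y] x y by (simp add: dist_real_def)
  next
    case False
    then show ?thesis using d[OF y] r_lipschitz[of y x] x y by (simp add: dist_real_def)
  qed
  then show "\<exists>d>0. \<forall>y\<in>{a..b}. dist y x < d \<longrightarrow> dist (r y) (r x) < e"
    using \<open>0 < d\<close> by blast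
qed

lemma weight_continuous:
  assumes "continuous_on S \<rho>" "\<And>t. t \<in> S \<Longrightarrow> 0 \<le> \<rho> t \<and> \<rho> t < (1::real)"
  shows "continuous_on S (\<lambda>t. 1 / (1 - (\<rho> t)\<^sup>2))"
proof (intro continuous_intros assms(1) ballI)
  fix t assume "t \<in> S"
  then have "(\<rho> t)\<^sup>2 < 1" using assms(2) by (simp add: abs_square_less_1)
  then show "1 - (\<rho> t)\<^sup>2 \<noteq> 0" by simp
qed

lemma weight_mono:
  fixes x y :: real
  assumes "0 \<le> x" "x \<le> y" "y < 1"
  shows "1 / (1 - x\<^sup>2) \<le> 1 / (1 - y\<^sup>2)"
proof -
  have "y\<^sup>2 < 1" "x\<^sup>2 \<le> y\<^sup>2" using assms by (auto simp: abs_square_less_1 intro: power_mono)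
  then show ?thesis by (intro divide_left_mono mult_pos_pos) auto
qed

lemma weight_strict_mono:
  fixes x y :: real
  assumes "0 \<le> x" "x < y" "y < 1"
  shows "1 / (1 - x\<^sup>2) < 1 / (1 - y\<^sup>2)"
proof -
  have "y\<^sup>2 < 1" "x\<^sup>2 < y\<^sup>2" using assms by (auto simp: abs_square_less_1 intro: power_strict_mono)
  then show ?thesis by (intro divide_strict_left_mono mult_pos_pos) auto
qed

abbreviation len :: "real \<Rightarrow> real \<Rightarrow> real"
  where "len c d \<equiv> integral {c..d} (\<lambda>t. 1 / (1 - (r t)\<^sup>2) * s t)"

lemma len_integrable:
  "a \<le> c \<Longrightarrow> d \<le> b \<Longrightarrow> (\<lambda>t. 1 / (1 - (r t)\<^sup>2) * s t) integrable_on {c..d}"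
  by (intro integrable_weight_sub weight_continuous r_continuous r_range)

lemma len_combine: "a \<le> c \<Longrightarrow> c \<le> d \<Longrightarrow> d \<le> e \<Longrightarrow> e \<le> b \<Longrightarrow> len c e = len c d + len d e"
  by (rule Henstock_Kurzweil_Integration.integral_combine[symmetric]) (assumption | rule len_integrable | linarith)+

text \<open>The two cases \<open>\<sigma> = -1\<close> and \<open>\<sigma> = 1\<close> are the arcs towards and away from the centre.\<close>

lemma len_affine:
  assumes cd: "a \<le> c" "c \<le> d" "d \<le> b" and \<sigma>: "\<sigma> = 1 \<or> \<sigma> = - 1"
    and bounds: "\<And>t. t \<in> {c..d} \<Longrightarrow> 0 \<le> \<alpha> + \<sigma> * A t \<and> \<alpha> + \<sigma> * A t < 1"
  shows "integral {c..d} (\<lambda>t. 1 / (1 - (\<alpha> + \<sigma> * A t)\<^sup>2) * s t)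
    = \<sigma> * (artanh (\<alpha> + \<sigma> * A d) - artanh (\<alpha> + \<sigma> * A c))"
proof -
  have "integral {c..d} (\<lambda>t. (\<lambda>y. 1 / (1 - (\<alpha> + \<sigma> * y)\<^sup>2)) (A t) * s t)
      = (\<lambda>y. \<sigma> * artanh (\<alpha> + \<sigma> * y)) (A d) - (\<lambda>y. \<sigma> * artanh (\<alpha> + \<sigma> * y)) (A c)"
  proof (rule integral_substitution[OF cd])
    show "A ` {c..d} \<subseteq> {A c..A d}" using A_mono cd by auto
    have range: "0 \<le> \<alpha> + \<sigma> * y \<and> \<alpha> + \<sigma> * y < 1" if "y \<in> {A c..A d}" for y
      using that bounds[of c] bounds[of d] cd \<sigma> by auto
    then show "continuous_on {A c..A d} (\<lambda>y. 1 / (1 - (\<alpha> + \<sigma> * y)\<^sup>2))"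
      by (intro weight_continuous continuous_intros)
    fix y assume "y \<in> {A c..A d}"
    from range[OF this] have "\<bar>\<alpha> + \<sigma> * y\<bar> < 1" by simp
    then have "((\<lambda>y. \<sigma> * artanh (\<alpha> + \<sigma> * y)) has_real_derivative
        \<sigma> * (1 / (1 - (\<alpha> + \<sigma> * y)\<^sup>2) * \<sigma>)) (at y within {A c..A d})"
      by (intro DERIV_cmult DERIV_chain2[of artanh] artanh_real_has_field_derivative)
        (auto intro!: derivative_eq_intros)
    then show "((\<lambda>y. \<sigma> * artanh (\<alpha> + \<sigma> * y)) has_real_derivative 1 / (1 - (\<alpha> + \<sigma> * y)\<^sup>2))
        (at y within {A c..A d})"
      using \<sigma> by auto
  qed
  then show ?thesis by (simp add: right_diff_distrib)
qed

text \<open>The weight grows with the radius, so replacing \<open>r\<close> by a smaller affine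
  function of \<open>A\<close> can only decrease the integral, which then has a closed form.\<close>

lemma len_ge_affine:
  assumes cd: "a \<le> c" "c \<le> d" "d \<le> b" and \<sigma>: "\<sigma> = 1 \<or> \<sigma> = - 1"
    and bounds: "\<And>t. t \<in> {c..d} \<Longrightarrow> 0 \<le> \<alpha> + \<sigma> * A t \<and> \<alpha> + \<sigma> * A t \<le> r t"
  shows "\<sigma> * (artanh (\<alpha> + \<sigma> * A d) - artanh (\<alpha> + \<sigma> * A c)) \<le> len c d"
proof -
  have lt: "0 \<le> \<alpha> + \<sigma> * A t \<and> \<alpha> + \<sigma> * A t < 1" if "t \<in> {c..d}" for t
    using bounds[OF that] r_range[of t] that cd by auto
  have cont: "continuous_on {c..d} A" by (rule continuous_on_subset[OF A_continuous]) (use cd in auto)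
  interpret cd: integrated_speed c d s A
  proof
    show "s absolutely_integrable_on {c..d}"
      by (rule set_integrable_subset[OF s_abs]) (use cd in auto)
  qed (use cd s_nonneg A in auto)
  have "integral {c..d} (\<lambda>t. 1 / (1 - (\<alpha> + \<sigma> * A t)\<^sup>2) * s t) \<le> len c d"
  proof (rule integral_le)
    show "(\<lambda>t. 1 / (1 - (\<alpha> + \<sigma> * A t)\<^sup>2) * s t) integrable_on {c..d}"
      using lt by (intro cd.integrable_weight_sub weight_continuous continuous_intros cont) auto
    show "(\<lambda>t. 1 / (1 - (r t)\<^sup>2) * s t) integrable_on {c..d}"
      using len_integrable cd by auto
    fix t assume "t \<in> {c..d}"
    then show "1 / (1 - (\<alpha> + \<sigma> * A t)\<^sup>2) * s t \<le> 1 / (1 - (r t)\<^sup>2) * s t"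
      using bounds r_range[of t] s_nonneg[of t] cd by (intro mult_right_mono weight_mono) auto
  qed
  then show ?thesis using len_affine[OF cd \<sigma> lt] by simp
qed

lemma len_eq_affine:
  assumes cd: "a \<le> c" "c \<le> d" "d \<le> b" and \<sigma>: "\<sigma> = 1 \<or> \<sigma> = - 1"
    and eq: "\<And>t. t \<in> {c..d} \<Longrightarrow> r t = \<alpha> + \<sigma> * A t"
  shows "len c d = \<sigma> * (artanh (\<alpha> + \<sigma> * A d) - artanh (\<alpha> + \<sigma> * A c))"
proof -
  have "len c d = integral {c..d} (\<lambda>t. 1 / (1 - (\<alpha> + \<sigma> * A t)\<^sup>2) * s t)"
    by (rule integral_cong) (simp add: eq)
  also have "\<dots> = \<sigma> * (artanh (\<alpha> + \<sigma> * A d) - artanh (\<alpha> + \<sigma> * A c))"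
    using eq r_range cd by (intro len_affine[OF cd \<sigma>]) (metis atLeastAtMost_iff order_trans)
  finally show ?thesis .
qed

text \<open>By continuity the gap at \<open>d\<close> persists on some \<open>{u..d}\<close>, where
  the weights differ by at least a positive minimum; \<open>grow\<close> ensures that distance is
  covered there, so the integrals differ strictly.\<close>

lemma len_gt_affine:
  assumes cd: "a \<le> c" "c < d" "d \<le> b" and \<sigma>: "\<sigma> = 1 \<or> \<sigma> = - 1"
    and bounds: "\<And>t. t \<in> {c..d} \<Longrightarrow> 0 \<le> \<alpha> + \<sigma> * A t \<and> \<alpha> + \<sigma> * A t \<le> r t"
    and gap: "\<alpha> + \<sigma> * A d < r d"
    and grow: "\<And>u. c \<le> u \<Longrightarrow> u < d \<Longrightarrow> A u < A d"
  shows "\<sigma> * (artanh (\<alpha> + \<sigma> * A d) - artanh (\<alpha> + \<sigma> * A c)) < len c d"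
proof -
  define \<rho> where "\<rho> t = \<alpha> + \<sigma> * A t" for t
  have cont: "continuous_on {c..d} \<rho>" "continuous_on {c..d} r"
    unfolding \<rho>_def using A_continuous r_continuous cd by (auto intro!: continuous_intros elim: continuous_on_subset)
  have lt: "0 \<le> \<alpha> + \<sigma> * A t \<and> \<alpha> + \<sigma> * A t < 1" if "t \<in> {c..d}" for t
    using bounds[OF that] r_range[of t] that cd by auto
  obtain u where u: "c \<le> u" "u < d" "\<And>t. t \<in> {u..d} \<Longrightarrow> \<rho> t < r t"
  proof -
    have "continuous_on {c..d} (\<lambda>t. r t - \<rho> t)" using cont by (intro continuous_intros)
    moreover have "d \<in> {c..d}" "0 < r d - \<rho> d" using cd gap by (auto simp: \<rho>_def)
    ultimately obtain \<epsilon> where "0 < \<epsilon>" and \<epsilon>: "\<And>t. t \<in> {c..d} \<Longrightarrow> dist t d < \<epsilon> \<Longrightarrow>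
        dist (r t - \<rho> t) (r d - \<rho> d) < r d - \<rho> d"
      unfolding continuous_on_iff by blast
    show thesis
    proof (rule that[of "max c (d - \<epsilon> / 2)"])
      fix t assume "t \<in> {max c (d - \<epsilon> / 2)..d}"
      then have "dist (r t - \<rho> t) (r d - \<rho> d) < r d - \<rho> d"
        using \<open>0 < \<epsilon>\<close> by (intro \<epsilon>) (auto simp: dist_real_def)
      then show "\<rho> t < r t" by (auto simp: dist_real_def)
    qed (use cd \<open>0 < \<epsilon>\<close> in auto)
  qed
  interpret cd: integrated_speed c d s A
  proof
    show "s absolutely_integrable_on {c..d}"
      by (rule set_integrable_subset[OF s_abs]) (use cd in auto)
  qed (use cd s_nonneg A in auto)
  let ?w = "\<lambda>t. 1 / (1 - (r t)\<^sup>2) - 1 / (1 - (\<rho> t)\<^sup>2)"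
  have rr: "0 \<le> r t \<and> r t < 1" "0 \<le> \<rho> t \<and> \<rho> t < 1" "\<rho> t \<le> r t" if "t \<in> {c..d}" for t
    using r_range[of t] lt[OF that] bounds[OF that] that cd by (auto simp: \<rho>_def)
  have wcont: "continuous_on {c..d} ?w"
    by (intro continuous_on_diff weight_continuous cont rr)
  have "\<exists>t0\<in>{u..d}. \<forall>t\<in>{u..d}. ?w t0 \<le> ?w t"
    using u by (intro continuous_attains_inf continuous_on_subset[OF wcont]) auto
  then obtain t0 where t0: "t0 \<in> {u..d}" "\<And>t. t \<in> {u..d} \<Longrightarrow> ?w t0 \<le> ?w t" by blast
  have "0 < ?w t0"
    using weight_strict_mono[of "\<rho> t0" "r t0"] rr[of t0] u t0(1) by auto
  then have "0 < ?w t0 * (A d - A u)" using grow[OF u(1,2)] by simp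
  also have "\<dots> \<le> integral {u..d} (\<lambda>t. ?w t * s t)"
    using t0(2) u by (intro cd.weight_le_integral wcont) auto
  also have "\<dots> \<le> integral {c..u} (\<lambda>t. ?w t * s t) + integral {u..d} (\<lambda>t. ?w t * s t)"
  proof -
    have "0 * (A u - A c) \<le> integral {c..u} (\<lambda>t. ?w t * s t)"
    proof (rule cd.weight_le_integral[OF wcont])
      fix t assume "t \<in> {c..u}"
      then show "0 \<le> ?w t" using weight_mono[of "\<rho> t" "r t"] rr[of t] u by auto
    qed (use u in auto)
    then show ?thesis by simp
  qed
  also have "\<dots> = integral {c..d} (\<lambda>t. ?w t * s t)"
    by (rule Henstock_Kurzweil_Integration.integral_combine)
      (use u cd.integrable_weight_sub[OF wcont] in auto)
  also have "\<dots> = len c d - integral {c..d} (\<lambda>t. 1 / (1 - (\<rho> t)\<^sup>2) * s t)"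
  proof -
    have "(\<lambda>t. 1 / (1 - (\<rho> t)\<^sup>2) * s t) integrable_on {c..d}"
      by (intro cd.integrable_weight_sub weight_continuous cont rr) auto
    moreover have "(\<lambda>t. 1 / (1 - (r t)\<^sup>2) * s t) integrable_on {c..d}"
      using len_integrable cd by auto
    ultimately show ?thesis
      by (simp add: left_diff_distrib Henstock_Kurzweil_Integration.integral_diff)
  qed
  also have "integral {c..d} (\<lambda>t. 1 / (1 - (\<rho> t)\<^sup>2) * s t)
      = \<sigma> * (artanh (\<alpha> + \<sigma> * A d) - artanh (\<alpha> + \<sigma> * A c))"
    unfolding \<rho>_def using cd lt by (intro len_affine \<sigma>) auto
  finally show ?thesis by simp
qed

text \<open>The stretches towards radius \<open>M\<close> and away from it are compared with affine
  radii. Equality leaves no distance for the middle stretch and forces radius \<open>M\<close> at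
  the end of the first. Conversely, if the total distance is \<open>r a + r b - 2 * M\<close> and
  \<open>M\<close> is attained, then \<open>r\<close> is affine in \<open>A\<close> on both sides of
  that time and the length is computed exactly.\<close>

theorem len_ge_and_eq_iff:
  assumes M: "0 \<le> M" "M \<le> r a" "M \<le> r b" and far: "r a + r b - 2 * M \<le> A b - A a"
  shows "artanh (r a) + artanh (r b) - 2 * artanh M \<le> len a b"
    and "len a b = artanh (r a) + artanh (r b) - 2 * artanh M \<longleftrightarrow>
      A b - A a = r a + r b - 2 * M \<and> (\<exists>t\<in>{a..b}. r t = M)"
proof -
  define P where "P = r a"
  define Q where "Q = r b"
  have lowP: "P - (A t - A a) \<le> r t" if "t \<in> {a..b}" for t
    using r_lipschitz[of a t] that by (auto simp: P_def abs_le_iff)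
  have lowQ: "Q - (A b - A t) \<le> r t" if "t \<in> {a..b}" for t
    using r_lipschitz[of t b] that by (auto simp: Q_def abs_le_iff)
  have MPQ: "M \<le> P" "M \<le> Q" "P + Q - 2 * M \<le> A b - A a" using M far by (auto simp: P_def Q_def)
  \<comment> \<open>The split point \<open>t0\<close> is the first time in \<open>T\<close>: then \<open>A\<close> grows strictly up to \<open>t0\<close>, which the
    equality case needs to conclude \<open>r t0 = M\<close>.\<close>
  define T where "T = {t \<in> {a..b}. A t = A a + (P - M)}"
  have "compact T"
  proof -
    have "T = {a..b} \<inter> A -` {A a + (P - M)}" by (auto simp: T_def)
    moreover have "closed \<dots>"
      by (rule continuous_closed_preimage[OF A_continuous closed_atLeastAtMost closed_singleton])
    ultimately show ?thesis
      unfolding compact_eq_bounded_closed by (simp add: bounded_Int)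
  qed
  moreover have "T \<noteq> {}"
  proof -
    have "\<exists>t\<ge>a. t \<le> b \<and> A t = A a + (P - M)"
      by (rule IVT') (use MPQ ab A_continuous in auto)
    then show ?thesis by (auto simp: T_def)
  qed
  ultimately have "\<exists>t0\<in>T. \<forall>t\<in>T. t0 \<le> t"
    by (rule compact_attains_inf)
  then obtain t0 where t0T: "t0 \<in> T" and first: "\<And>t. t \<in> T \<Longrightarrow> t0 \<le> t"
    by blast
  then have t0: "a \<le> t0" "t0 \<le> b" "A t0 = A a + (P - M)" by (auto simp: T_def)
  have grow: "A u < A t0" if "a \<le> u" "u < t0" for u
  proof -
    have "A u \<le> A t0" using A_mono[of u t0] that t0 by simp
    moreover have "u \<notin> T" using first that by force
    ultimately show ?thesis using that t0 by (auto simp: T_def)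
  qed
  have "\<exists>t\<ge>t0. t \<le> b \<and> A t = A b - (Q - M)"
    by (rule IVT') (use MPQ t0 continuous_on_subset[OF A_continuous] in auto)
  then obtain t1 where t1: "t0 \<le> t1" "t1 \<le> b" "A t1 = A b - (Q - M)" by blast
  have b1: "0 \<le> (P + A a) + - 1 * A t \<and> (P + A a) + - 1 * A t \<le> r t" if "t \<in> {a..t0}" for t
    using lowP[of t] A_mono[of t t0] that t0 M(1) by auto
  have b3: "0 \<le> (Q - A b) + 1 * A t \<and> (Q - A b) + 1 * A t \<le> r t" if "t \<in> {t1..b}" for t
    using lowQ[of t] A_mono[of t1 t] that t0 t1 M(1) by auto
  have I1: "artanh P - artanh M \<le> len a t0"
    using len_ge_affine[of a t0 "- 1" "P + A a", OF _ _ _ _ b1] t0 by simp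
  have I3: "artanh Q - artanh M \<le> len t1 b"
    using len_ge_affine[of t1 b 1 "Q - A b", OF _ _ _ _ b3] t0 t1 by simp
  \<comment> \<open>The weight is at least 1 throughout, so the middle stretch costs at least the
    distance covered on it.\<close>
  have I2: "A t1 - A t0 \<le> len t0 t1"
  proof -
    have "1 * (A t1 - A t0) \<le> len t0 t1"
    proof (intro weight_le_integral weight_continuous r_continuous r_range)
      fix t assume "t \<in> {t0..t1}"
      then show "1 \<le> 1 / (1 - (r t)\<^sup>2)"
        using weight_mono[of 0 "r t"] r_range[of t] t0 t1 by auto
    qed (use t0 t1 in auto)
    then show ?thesis by simp
  qed
  have split: "len a b = len a t0 + len t0 t1 + len t1 b"
    using len_combine[of a t0 b] len_combine[of t0 t1 b] t0 t1 by simp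
  have pos: "0 \<le> A t1 - A t0" using A_mono[OF t0(1) t1(1,2)] by simp
  have "artanh P + artanh Q - 2 * artanh M \<le> len a b"
    using I1 I2 I3 split pos by linarith
  then show "artanh (r a) + artanh (r b) - 2 * artanh M \<le> len a b"
    by (simp add: P_def Q_def)
  show "len a b = artanh (r a) + artanh (r b) - 2 * artanh M \<longleftrightarrow>
      A b - A a = r a + r b - 2 * M \<and> (\<exists>t\<in>{a..b}. r t = M)"
  proof
    assume "len a b = artanh (r a) + artanh (r b) - 2 * artanh M"
    then have eq: "len a b = artanh P + artanh Q - 2 * artanh M" by (simp add: P_def Q_def)
    have "A t1 - A t0 = 0" and I1eq: "len a t0 = artanh P - artanh M"
      using eq I1 I2 I3 split pos by linarith+
    then have "A b - A a = P + Q - 2 * M" using t0 t1 by simp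
    moreover have "r t0 = M"
    proof (rule ccontr)
      assume "r t0 \<noteq> M"
      moreover have "M \<le> r t0" using lowP[of t0] t0 by simp
      ultimately have gap: "M < r t0" by simp
      have "a \<noteq> t0"
      proof
        assume "a = t0"
        then show False using gap t0(3) by (simp add: P_def)
      qed
      then have "- 1 * (artanh (P + A a + - 1 * A t0) - artanh (P + A a + - 1 * A a)) < len a t0"
        using t0 gap by (intro len_gt_affine b1 grow) auto
      then show False using I1eq t0(3) by simp
    qed
    ultimately show "A b - A a = r a + r b - 2 * M \<and> (\<exists>t\<in>{a..b}. r t = M)"
      using t0 by (auto simp: P_def Q_def)
  next
    assume "A b - A a = r a + r b - 2 * M \<and> (\<exists>t\<in>{a..b}. r t = M)"
    then obtain \<tau> where S: "A b - A a = P + Q - 2 * M" and \<tau>: "\<tau> \<in> {a..b}" "r \<tau> = M"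
      by (auto simp: P_def Q_def)
    \<comment> \<open>The two lower bounds for \<open>r\<close> at \<open>\<tau>\<close> pinch
      \<open>A \<tau>\<close>. Together with the Lipschitz bound between \<open>t\<close> and
      \<open>\<tau>\<close> they make \<open>r\<close> affine in \<open>A\<close> on either
      side.\<close>
    have A\<tau>: "A \<tau> = A a + (P - M)" using lowP[OF \<tau>(1)] lowQ[OF \<tau>(1)] S \<tau>(2) by simp
    have 1: "r t = (P + A a) + - 1 * A t" if "t \<in> {a..\<tau>}" for t
      using lowP[of t] r_lipschitz[of t \<tau>] that \<tau> A\<tau> by (auto simp: abs_le_iff)
    have 2: "r t = (Q - A b) + 1 * A t" if "t \<in> {\<tau>..b}" for t
      using lowQ[of t] r_lipschitz[of \<tau> t] that \<tau> A\<tau> S by (auto simp: abs_le_iff)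
    have "len a \<tau> = artanh P - artanh M"
      using len_eq_affine[of a \<tau> "- 1" "P + A a", OF _ _ _ _ 1] \<tau> A\<tau> by simp
    moreover have "len \<tau> b = artanh Q - artanh M"
    proof -
      have "(Q - A b) + 1 * A \<tau> = M" "(Q - A b) + 1 * A b = Q" using A\<tau> S by auto
      with len_eq_affine[of \<tau> b 1 "Q - A b", OF _ _ _ _ 2] \<tau> show ?thesis by simp
    qed
    ultimately show "len a b = artanh (r a) + artanh (r b) - 2 * artanh M"
      using len_combine[of a \<tau> b] \<tau> by (simp add: P_def Q_def)
  qed
qed

end

section \<open>The variation of a curve\<close>

text \<open>Holds the outcome of the fundamental theorem for one coordinate; the integral of
  \<open>\<bar>g t\<bar>\<close> then plays the role of its variation.\<close>

locale ac_derivative =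
  fixes a b :: real and f g :: "real \<Rightarrow> real" and N :: "real set"
  assumes ab: "a \<le> b" and N: "negligible N"
    and g_abs: "g absolutely_integrable_on {a..b}"
    and deriv: "\<And>x. x \<in> {a<..<b} - N \<Longrightarrow> (f has_real_derivative g x) (at x)"
    and g_int: "\<And>c d. a \<le> c \<Longrightarrow> c \<le> d \<Longrightarrow> d \<le> b \<Longrightarrow> (g has_integral f d - f c) {c..d}"
begin

lemma abs_integrable: "a \<le> c \<Longrightarrow> d \<le> b \<Longrightarrow> (\<lambda>t. \<bar>g t\<bar>) integrable_on {c..d}"
  using absolutely_integrable_norm[OF g_abs]
  by (intro integrable_on_subinterval[of _ "{a..b}" c d])
    (auto simp: absolutely_integrable_on_def o_def)

lemma diff_le_integral_abs:
  assumes "a \<le> c" "c \<le> d" "d \<le> b"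
  shows "\<bar>f d - f c\<bar> \<le> integral {c..d} (\<lambda>t. \<bar>g t\<bar>)"
  using integral_norm_bound_integral[of g "{c..d}" "\<lambda>t. \<bar>g t\<bar>"] g_int[OF assms] abs_integrable assms
  by (auto simp: integral_unique)

text \<open>Cutting at \<open>u\<close> and \<open>v\<close> and bounding the outer pieces below by
  their net increments leaves no room for a decrease in the middle. Conversely, monotonicity makes
  \<open>g\<close> nonnegative off a null set, so the modulus drops out.\<close>

lemma integral_abs_eq_diff_iff:
  "integral {a..b} (\<lambda>t. \<bar>g t\<bar>) = f b - f a \<longleftrightarrow> mono_on {a..b} f"
proof
  assume eq: "integral {a..b} (\<lambda>t. \<bar>g t\<bar>) = f b - f a"
  show "mono_on {a..b} f"
  proof (rule mono_onI)
    fix u v assume uv: "u \<in> {a..b}" "v \<in> {a..b}" "u \<le> v"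
    have "integral {a..b} (\<lambda>t. \<bar>g t\<bar>) = integral {a..u} (\<lambda>t. \<bar>g t\<bar>) + integral {u..b} (\<lambda>t. \<bar>g t\<bar>)"
      by (rule Henstock_Kurzweil_Integration.integral_combine[symmetric]) (use uv abs_integrable in auto)
    also have "integral {u..b} (\<lambda>t. \<bar>g t\<bar>) = integral {u..v} (\<lambda>t. \<bar>g t\<bar>) + integral {v..b} (\<lambda>t. \<bar>g t\<bar>)"
      by (rule Henstock_Kurzweil_Integration.integral_combine[symmetric]) (use uv abs_integrable in auto)
    finally have "integral {u..v} (\<lambda>t. \<bar>g t\<bar>) \<le> f v - f u"
      using eq diff_le_integral_abs[of a u] diff_le_integral_abs[of v b] uv by auto
    moreover have "0 \<le> integral {u..v} (\<lambda>t. \<bar>g t\<bar>)"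
      by (rule integral_nonneg) (use uv abs_integrable in auto)
    ultimately show "f u \<le> f v" by simp
  qed
next
  assume mono: "mono_on {a..b} f"
  have "((\<lambda>t. \<bar>g t\<bar>) has_integral f b - f a) {a..b}"
  proof (rule has_integral_spike[OF _ _ g_int])
    show "negligible (N \<union> {a, b})" using N by (intro negligible_Un) auto
    fix t assume "t \<in> {a..b} - (N \<union> {a, b})"
    then have t: "t \<in> {a<..<b} - N" by auto
    have "0 \<le> g t"
      by (rule mono_on_imp_deriv_nonneg[OF mono deriv[OF t]]) (use t in auto)
    then show "\<bar>g t\<bar> = g t" by simp
  qed (use ab in auto)
  then show "integral {a..b} (\<lambda>t. \<bar>g t\<bar>) = f b - f a" by (rule integral_unique)
qed

end

text \<open>The increasing case is applied to \<open>f\<close> and to its negative; nonnegativity of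
  the integral splits the absolute value into these two cases.\<close>

lemma (in ac_derivative) integral_abs_eq_iff_monotone:
  "integral {a..b} (\<lambda>t. \<bar>g t\<bar>) = \<bar>f b - f a\<bar> \<longleftrightarrow> mono_on {a..b} f \<or> antimono_on {a..b} f"
proof -
  interpret neg: ac_derivative a b "\<lambda>x. - f x" "\<lambda>x. - g x" N
  proof
    show "(\<lambda>x. - g x) absolutely_integrable_on {a..b}"
      using absolutely_integrable_scaleR_left[OF g_abs, of "- 1"] by simp
    show "((\<lambda>x. - f x) has_real_derivative - g x) (at x)" if "x \<in> {a<..<b} - N" for x
      using deriv[OF that] by (rule DERIV_minus)
    show "((\<lambda>x. - g x) has_integral - f d - - f c) {c..d}" if "a \<le> c" "c \<le> d" "d \<le> b" for c d
      using has_integral_neg[OF g_int[OF that]] by simp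
  qed (use ab N in auto)
  have anti: "mono_on {a..b} (\<lambda>x. - f x) \<longleftrightarrow> antimono_on {a..b} f"
    by (simp add: monotone_on_def)
  have nonneg: "0 \<le> integral {a..b} (\<lambda>t. \<bar>g t\<bar>)"
    by (rule integral_nonneg) (use abs_integrable in auto)
  have "integral {a..b} (\<lambda>t. \<bar>g t\<bar>) = \<bar>f b - f a\<bar> \<longleftrightarrow>
      integral {a..b} (\<lambda>t. \<bar>g t\<bar>) = f b - f a \<or> integral {a..b} (\<lambda>t. \<bar>g t\<bar>) = f a - f b"
    using nonneg by auto
  then show ?thesis
    using integral_abs_eq_diff_iff neg.integral_abs_eq_diff_iff anti by simp
qed

section \<open>Minimal points and L-shaped curves\<close>

lemma ell_between: "(x \<le> ell x y \<and> ell x y \<le> y) \<or> (y \<le> ell x y \<and> ell x y \<le> x)"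
  by (auto simp: ell_def sgn_if min_def split: if_splits)

lemma abs_ell_le: "\<bar>ell x y\<bar> \<le> \<bar>x\<bar>" "\<bar>ell x y\<bar> \<le> \<bar>y\<bar>"
  by (auto simp: ell_def sgn_if min_def split: if_splits)

text \<open>For equal signs the distance is the larger modulus minus the smaller, for opposite signs
  it is their sum; \<open>ell\<close> carries the smaller modulus in the first case and is 0 in the
  second.\<close>

lemma abs_diff_eq_ell: "\<bar>x - y\<bar> = \<bar>x\<bar> + \<bar>y\<bar> - 2 * \<bar>ell x y\<bar>"
  by (auto simp: ell_def sgn_if min_def split: if_splits)

text \<open>\<open>ell x y\<close> is the unique point nearest to 0 on the segment between
  \<open>x\<close> and \<open>y\<close>: 0 itself if the segment contains it, otherwise the closer
  end point.\<close>

lemma ell_minimal: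
  assumes "(x \<le> z \<and> z \<le> y) \<or> (y \<le> z \<and> z \<le> x)"
  shows "\<bar>ell x y\<bar> \<le> \<bar>z\<bar>" "\<bar>z\<bar> = \<bar>ell x y\<bar> \<longleftrightarrow> z = ell x y"
  using assms by (auto simp: ell_def sgn_if min_def split: if_splits)

lemma taxi_norm_minimal_point:
  "0 \<le> taxi_norm (minimal_point p q)"
  "taxi_norm (minimal_point p q) \<le> taxi_norm p"
  "taxi_norm (minimal_point p q) \<le> taxi_norm q"
  by (auto simp: taxi_norm_def minimal_point_def intro!: sum_mono sum_nonneg abs_ell_le)

lemma taxi_norm_diff_minimal_point:
  "taxi_norm (p - q) = taxi_norm p + taxi_norm q - 2 * taxi_norm (minimal_point p q)"
  by (simp add: taxi_norm_def minimal_point_def abs_diff_eq_ell sum.distrib sum_subtractf sum_distrib_left)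

text \<open>Monotonicity keeps each coordinate between its end values, where its modulus is at least
  that of \<open>ell\<close>. Equal sums therefore force equality in every coordinate, and the
  nearest point to 0 is unique.\<close>

lemma fully_monotonic_norm_eq_iff:
  fixes \<gamma> :: "real \<Rightarrow> real ^ 'n"
  assumes "fully_monotonic \<gamma>" "t \<in> {0..1}"
  shows "taxi_norm (\<gamma> t) = taxi_norm (minimal_point (\<gamma> 0) (\<gamma> 1)) \<longleftrightarrow> \<gamma> t = minimal_point (\<gamma> 0) (\<gamma> 1)"
proof
  assume eq: "taxi_norm (\<gamma> t) = taxi_norm (minimal_point (\<gamma> 0) (\<gamma> 1))"
  have btw: "(\<gamma> 0 $ i \<le> \<gamma> t $ i \<and> \<gamma> t $ i \<le> \<gamma> 1 $ i) \<or> (\<gamma> 1 $ i \<le> \<gamma> t $ i \<and> \<gamma> t $ i \<le> \<gamma> 0 $ i)" for i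
    using assms unfolding fully_monotonic_def monotone_on_def
    by (metis atLeastAtMost_iff order_refl zero_le_one)
  have "\<bar>\<gamma> t $ i\<bar> = \<bar>ell (\<gamma> 0 $ i) (\<gamma> 1 $ i)\<bar>" for i
  proof -
    have "(\<Sum>i\<in>UNIV. \<bar>ell (\<gamma> 0 $ i) (\<gamma> 1 $ i)\<bar>) = (\<Sum>i\<in>UNIV. \<bar>\<gamma> t $ i\<bar>)"
      using eq by (simp add: taxi_norm_def minimal_point_def)
    from sum_mono_inv[OF this] show ?thesis
      using ell_minimal(1)[OF btw] by simp
  qed
  then show "\<gamma> t = minimal_point (\<gamma> 0) (\<gamma> 1)"
    using ell_minimal(2)[OF btw] by (simp add: vec_eq_iff minimal_point_def)
qed simp

section \<open>The length of an arbitrary curve between two points\<close>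

text \<open>\<open>\<Lambda>\<close> depends on the end points alone, so it is the least length as
  soon as one curve attains it. The radial estimate is applied with the taxicab norm as radius and
  the sum of the coordinate speeds as speed.\<close>

lemma curve_length_characterization:
  fixes p q :: "real ^ 'n" and \<gamma> :: "real \<Rightarrow> real ^ 'n"
  assumes "\<gamma> \<in> curves p q"
  defines "\<Lambda> \<equiv> artanh (taxi_norm p) + artanh (taxi_norm q) - 2 * artanh (taxi_norm (minimal_point p q))"
  shows "\<Lambda> \<le> curve_length 0 1 \<gamma>"
    and "curve_length 0 1 \<gamma> = \<Lambda> \<longleftrightarrow> fully_monotonic \<gamma> \<and> minimal_point p q \<in> \<gamma> ` {0..1}"
proof -
  have ball: "\<And>t. t \<in> {0..1} \<Longrightarrow> \<gamma> t \<in> taxi_ball" and ends: "\<gamma> 0 = p" "\<gamma> 1 = q"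
    and ac: "\<And>i. absolutely_continuous_on 0 1 (\<lambda>t. \<gamma> t $ i)"
    using assms(1) by (auto simp: curves_def)
  have "\<exists>g N. ac_derivative 0 1 (\<lambda>t. \<gamma> t $ i) g N" for i
  proof -
    obtain g N where "negligible N" "g absolutely_integrable_on {0..1}"
      "\<And>x. x \<in> {0<..<1} - N \<Longrightarrow> ((\<lambda>t. \<gamma> t $ i) has_real_derivative g x) (at x)"
      "\<And>c d. 0 \<le> c \<Longrightarrow> c \<le> d \<Longrightarrow> d \<le> 1 \<Longrightarrow> (g has_integral \<gamma> d $ i - \<gamma> c $ i) {c..d}"
      by (rule absolutely_continuous_on_fundamental_theorem[OF ac zero_le_one]) blast
    then have "ac_derivative 0 1 (\<lambda>t. \<gamma> t $ i) g N" by unfold_locales auto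
    then show ?thesis by blast
  qed
  then obtain g N where gN: "\<And>i. ac_derivative 0 1 (\<lambda>t. \<gamma> t $ i) (g i) (N i)" by metis
  \<comment> \<open>Almost everywhere this is the taxicab norm of the velocity; built from the
    \<open>g i\<close>, it integrates to the sum of the coordinate variations.\<close>
  define s where "s t = (\<Sum>i\<in>UNIV. \<bar>g i t\<bar>)" for t
  define A where "A t = integral {0..t} s" for t
  have s_abs: "s absolutely_integrable_on {0..1}"
    unfolding s_def
    using absolutely_integrable_norm[OF ac_derivative.g_abs[OF gN]]
    by (intro absolutely_integrable_sum) (auto simp: o_def)
  have s_sub: "s integrable_on {c..d}" if "0 \<le> c" "d \<le> 1" for c d
    by (rule integrable_on_subinterval[OF set_lebesgue_integral_eq_integral(1)[OF s_abs]]) (use that in auto)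
  have A_diff: "A d - A c = integral {c..d} s" if "0 \<le> c" "c \<le> d" "d \<le> 1" for c d
    using Henstock_Kurzweil_Integration.integral_combine[of 0 c d s] s_sub that by (simp add: A_def)
  have A_sum: "A d - A c = (\<Sum>i\<in>UNIV. integral {c..d} (\<lambda>t. \<bar>g i t\<bar>))" if "0 \<le> c" "c \<le> d" "d \<le> 1" for c d
    unfolding A_diff[OF that] s_def
    using ac_derivative.abs_integrable[OF gN that(1,3)] by (intro integral_sum) auto
  interpret radial_path 0 1 s A "\<lambda>t. taxi_norm (\<gamma> t)"
  proof
    show "(s has_integral A d - A c) {c..d}" if "0 \<le> c" "c \<le> d" "d \<le> 1" for c d
      unfolding A_diff[OF that] using s_sub that by (simp add: integrable_integral)
    show "0 \<le> taxi_norm (\<gamma> t) \<and> taxi_norm (\<gamma> t) < 1" if "t \<in> {0..1}" for t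
      using ball[OF that] by (auto simp: taxi_ball_def taxi_norm_def intro: sum_nonneg)
    fix u v :: real assume uv: "0 \<le> u" "u \<le> v" "v \<le> 1"
    have "\<bar>taxi_norm (\<gamma> v) - taxi_norm (\<gamma> u)\<bar> \<le> (\<Sum>i\<in>UNIV. \<bar>\<bar>\<gamma> v $ i\<bar> - \<bar>\<gamma> u $ i\<bar>\<bar>)"
      unfolding taxi_norm_def sum_subtractf[symmetric] by (rule sum_abs)
    also have "\<dots> \<le> (\<Sum>i\<in>UNIV. integral {u..v} (\<lambda>t. \<bar>g i t\<bar>))"
    proof (rule sum_mono)
      fix i
      show "\<bar>\<bar>\<gamma> v $ i\<bar> - \<bar>\<gamma> u $ i\<bar>\<bar> \<le> integral {u..v} (\<lambda>t. \<bar>g i t\<bar>)"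
        using ac_derivative.diff_le_integral_abs[OF gN uv, of i] by linarith
    qed
    finally show "\<bar>taxi_norm (\<gamma> v) - taxi_norm (\<gamma> u)\<bar> \<le> A v - A u"
      using A_sum[OF uv] by simp
  qed (auto simp: s_abs s_def intro: sum_nonneg)
  \<comment> \<open>The union of the coordinate null sets, enlarged by the end points because the
    coordinates are differentiated only inside the interval.\<close>
  let ?E = "(\<Union>i. N i) \<union> {0, 1}"
  have E: "negligible ?E"
    using ac_derivative.N[OF gN] by (intro negligible_Un negligible_Union) auto
  have vd: "vector_derivative \<gamma> (at t within {0..1}) = (\<chi> i. g i t)" if t: "t \<in> {0..1} - ?E" for t
  proof (rule vector_derivative_at_within_ivl)
    have "((\<lambda>t. \<gamma> t $ i) has_real_derivative g i t) (at t)" for i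
      using t by (intro ac_derivative.deriv[OF gN]) auto
    then show "(\<gamma> has_vector_derivative (\<chi> i. g i t)) (at t)"
      unfolding has_vector_derivative_def has_derivative_componentwise_within[of \<gamma>]
      by (auto simp: Basis_vec_def inner_axis has_field_derivative_def mult_commute_abs)
  qed (use t in auto)
  have spike: "taxi_norm (vector_derivative \<gamma> (at t within {0..1})) / (1 - (taxi_norm (\<gamma> t))\<^sup>2)
      = 1 / (1 - (taxi_norm (\<gamma> t))\<^sup>2) * s t" if "t \<in> {0..1} - ?E" for t
    unfolding vd[OF that] by (simp add: taxi_norm_def s_def)
  \<comment> \<open>\<open>curve_length\<close> is a Lebesgue integral; absolute integrability
    identifies it with the gauge integral of the estimates.\<close>
  have "(\<lambda>t. 1 / (1 - (taxi_norm (\<gamma> t))\<^sup>2) * s t) absolutely_integrable_on {0..1}"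
    by (intro integrable_weight weight_continuous r_continuous r_range)
  then have "(\<lambda>t. taxi_norm (vector_derivative \<gamma> (at t within {0..1})) / (1 - (taxi_norm (\<gamma> t))\<^sup>2))
      absolutely_integrable_on {0..1}"
    by (rule absolutely_integrable_spike[OF _ E spike])
  then have "curve_length 0 1 \<gamma> =
      integral {0..1} (\<lambda>t. taxi_norm (vector_derivative \<gamma> (at t within {0..1})) / (1 - (taxi_norm (\<gamma> t))\<^sup>2))"
    unfolding curve_length_def by (rule set_lebesgue_integral_eq_integral(2))
  also have "\<dots> = len 0 1"
    by (rule integral_spike[OF E]) (simp only: spike)
  finally have length: "curve_length 0 1 \<gamma> = len 0 1" .
  let ?M = "taxi_norm (minimal_point p q)"
  have le: "\<bar>p $ i - q $ i\<bar> \<le> integral {0..1} (\<lambda>t. \<bar>g i t\<bar>)" for i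
    using ac_derivative.diff_le_integral_abs[OF gN, of 0 1 i] ends by (simp add: abs_minus_commute)
  have total: "A 1 - A 0 = (\<Sum>i\<in>UNIV. integral {0..1} (\<lambda>t. \<bar>g i t\<bar>))"
    by (rule A_sum) auto
  have far: "taxi_norm (p - q) \<le> A 1 - A 0"
    unfolding total by (auto simp: taxi_norm_def intro: sum_mono le)
  \<comment> \<open>Variation dominates displacement coordinate by coordinate, so the sums agree
    only if they agree in every coordinate.\<close>
  have "A 1 - A 0 = taxi_norm (p - q) \<longleftrightarrow> (\<forall>i. integral {0..1} (\<lambda>t. \<bar>g i t\<bar>) = \<bar>p $ i - q $ i\<bar>)"
  proof
    assume "A 1 - A 0 = taxi_norm (p - q)"
    then have "(\<Sum>i\<in>UNIV. \<bar>p $ i - q $ i\<bar>) = (\<Sum>i\<in>UNIV. integral {0..1} (\<lambda>t. \<bar>g i t\<bar>))"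
      unfolding total by (simp add: taxi_norm_def)
    from sum_mono_inv[OF this] le show "\<forall>i. integral {0..1} (\<lambda>t. \<bar>g i t\<bar>) = \<bar>p $ i - q $ i\<bar>" by simp
  qed (simp add: total taxi_norm_def)
  also have "\<dots> \<longleftrightarrow> fully_monotonic \<gamma>"
    using ac_derivative.integral_abs_eq_iff_monotone[OF gN] ends
    by (simp add: fully_monotonic_def abs_minus_commute)
  finally have mono_iff: "A 1 - A 0 = taxi_norm (p - q) \<longleftrightarrow> fully_monotonic \<gamma>" .
  have far': "taxi_norm (\<gamma> 0) + taxi_norm (\<gamma> 1) - 2 * ?M \<le> A 1 - A 0"
    using far by (simp add: ends taxi_norm_diff_minimal_point)
  have M: "0 \<le> ?M" "?M \<le> taxi_norm (\<gamma> 0)" "?M \<le> taxi_norm (\<gamma> 1)"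
    using taxi_norm_minimal_point[of p q] by (auto simp: ends)
  show "\<Lambda> \<le> curve_length 0 1 \<gamma>"
    using len_ge_and_eq_iff(1)[OF M far'] by (simp add: length \<Lambda>_def ends)
  have "curve_length 0 1 \<gamma> = \<Lambda> \<longleftrightarrow>
      A 1 - A 0 = taxi_norm (p - q) \<and> (\<exists>t\<in>{0..1}. taxi_norm (\<gamma> t) = ?M)"
    using len_ge_and_eq_iff(2)[OF M far']
    by (simp only: length \<Lambda>_def ends taxi_norm_diff_minimal_point)
  also have "\<dots> \<longleftrightarrow> fully_monotonic \<gamma> \<and> (\<exists>t\<in>{0..1}. taxi_norm (\<gamma> t) = ?M)"
    unfolding mono_iff ..
  also have "\<dots> \<longleftrightarrow> fully_monotonic \<gamma> \<and> minimal_point p q \<in> \<gamma> ` {0..1}"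
  proof (rule conj_cong[OF refl])
    assume "fully_monotonic \<gamma>"
    then have "taxi_norm (\<gamma> t) = ?M \<longleftrightarrow> \<gamma> t = minimal_point p q" if "t \<in> {0..1}" for t
      using fully_monotonic_norm_eq_iff[of \<gamma> t] that by (simp add: ends)
    then show "(\<exists>t\<in>{0..1}. taxi_norm (\<gamma> t) = ?M) \<longleftrightarrow> minimal_point p q \<in> \<gamma> ` {0..1}"
      by (metis image_iff)
  qed
  finally show "curve_length 0 1 \<gamma> = \<Lambda> \<longleftrightarrow> fully_monotonic \<gamma> \<and> minimal_point p q \<in> \<gamma> ` {0..1}" .
qed

section \<open>The L-shaped curve as a minimizer\<close>

lemma lipschitz_imp_absolutely_continuous_on:
  assumes "\<And>x y. a \<le> x \<Longrightarrow> x \<le> y \<Longrightarrow> y \<le> b \<Longrightarrow> \<bar>f y - f x\<bar> \<le> C * (y - x)"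
  shows "absolutely_continuous_on a b f"
  unfolding absolutely_continuous_on_def
proof (intro allI impI)
  fix e :: real assume "0 < e"
  define d where "d = e / (\<bar>C\<bar> + 1)"
  have "0 < d" using \<open>0 < e\<close> by (simp add: d_def)
  have "(\<Sum>k<n. \<bar>f (v k) - f (u k)\<bar>) < e"
    if uv: "\<forall>k<n. a \<le> u k \<and> u k \<le> v k \<and> v k \<le> b" "(\<Sum>k<n. v k - u k) < d" for n :: nat and u v
  proof -
    have "(\<Sum>k<n. \<bar>f (v k) - f (u k)\<bar>) \<le> (\<Sum>k<n. (\<bar>C\<bar> + 1) * (v k - u k))"
    proof (rule sum_mono)
      fix k assume "k \<in> {..<n}"
      then have k: "a \<le> u k" "u k \<le> v k" "v k \<le> b" using uv(1) by auto
      have "C * (v k - u k) \<le> (\<bar>C\<bar> + 1) * (v k - u k)" using k by (intro mult_right_mono) auto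
      then show "\<bar>f (v k) - f (u k)\<bar> \<le> (\<bar>C\<bar> + 1) * (v k - u k)" using assms[OF k] by linarith
    qed
    also have "\<dots> = (\<bar>C\<bar> + 1) * (\<Sum>k<n. v k - u k)" by (simp add: sum_distrib_left)
    also have "\<dots> < (\<bar>C\<bar> + 1) * d" using uv(2) by (intro mult_strict_left_mono) auto
    also have "\<dots> = e" by (simp add: d_def)
    finally show ?thesis .
  qed
  then show "\<exists>\<delta>>0. \<forall>(n::nat) u v. (\<forall>k<n. a \<le> u k \<and> u k \<le> v k \<and> v k \<le> b) \<longrightarrow>
      disjoint_family_on (\<lambda>k. {u k<..<v k}) {..<n} \<longrightarrow>
      (\<Sum>k<n. v k - u k) < \<delta> \<longrightarrow> (\<Sum>k<n. \<bar>f (v k) - f (u k)\<bar>) < e"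
    using \<open>0 < d\<close> by blast
qed

text \<open>One formula for both halves: each \<open>max\<close> term vanishes on the half belonging
  to the other, which spares case distinctions for the Lipschitz bound and monotonicity.\<close>

lemma L_curve_component:
  "L_curve p q t $ i = minimal_point p q $ i
    + (p $ i - minimal_point p q $ i) * max 0 (1 - 2 * t)
    + (q $ i - minimal_point p q $ i) * max 0 (2 * t - 1)"
  by (cases "t = 1 / 2") (auto simp: L_curve_def joinpaths_def linepath_def max_def algebra_simps)

lemma L_curve_in_curves:
  assumes "p \<in> taxi_ball" "q \<in> taxi_ball"
  shows "L_curve p q \<in> curves p q"
proof -
  let ?m = "minimal_point p q"
  have "L_curve p q t \<in> taxi_ball" if t: "t \<in> {0..1}" for t
  proof -
    have m: "\<bar>?m $ i\<bar> \<le> \<bar>p $ i\<bar>" "\<bar>?m $ i\<bar> \<le> \<bar>q $ i\<bar>" for i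
      by (auto simp: minimal_point_def intro: abs_ell_le)
    \<comment> \<open>Each half joins an end point to the minimal point, whose coordinates have
      smaller or equal modulus, so convexity keeps the norm at most that of the end point.\<close>
    have conv: "\<bar>(1 - c) * y + c * x\<bar> \<le> \<bar>x\<bar>" if "\<bar>y\<bar> \<le> \<bar>x\<bar>" "0 \<le> c" "c \<le> 1" for x y c :: real
    proof -
      have "\<bar>(1 - c) * y + c * x\<bar> \<le> (1 - c) * \<bar>y\<bar> + c * \<bar>x\<bar>"
        using that abs_triangle_ineq[of "(1 - c) * y" "c * x"] by (simp add: abs_mult)
      also have "\<dots> \<le> (1 - c) * \<bar>x\<bar> + c * \<bar>x\<bar>" using that by (intro add_right_mono mult_left_mono) auto
      finally show ?thesis by (simp add: algebra_simps)
    qed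
    show ?thesis
    proof (cases "t \<le> 1 / 2")
      case True
      have "\<bar>L_curve p q t $ i\<bar> \<le> \<bar>p $ i\<bar>" for i
        using conv[OF m(1)[of i], of "1 - 2 * t"] True t by (simp add: L_curve_component max_def algebra_simps)
      then have "taxi_norm (L_curve p q t) \<le> taxi_norm p" by (auto simp: taxi_norm_def intro: sum_mono)
      then show ?thesis using assms(1) by (simp add: taxi_ball_def)
    next
      case False
      have "\<bar>L_curve p q t $ i\<bar> \<le> \<bar>q $ i\<bar>" for i
        using conv[OF m(2)[of i], of "2 * t - 1"] False t by (simp add: L_curve_component max_def algebra_simps)
      then have "taxi_norm (L_curve p q t) \<le> taxi_norm q" by (auto simp: taxi_norm_def intro: sum_mono)
      then show ?thesis using assms(2) by (simp add: taxi_ball_def)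
    qed
  qed
  moreover have "absolutely_continuous_on 0 1 (\<lambda>t. L_curve p q t $ i)" for i
  proof (rule lipschitz_imp_absolutely_continuous_on[where C = "2 * \<bar>p $ i - ?m $ i\<bar> + 2 * \<bar>q $ i - ?m $ i\<bar>"])
    fix x y :: real assume "x \<le> y"
    define c where "c = max 0 (1 - 2 * y) - max 0 (1 - 2 * x)"
    define d where "d = max 0 (2 * y - 1) - max 0 (2 * x - 1)"
    \<comment> \<open>Each \<open>max\<close> term is 2-Lipschitz, which explains the factors 2 in
      the constant \<open>C\<close>.\<close>
    have cd: "\<bar>c\<bar> \<le> 2 * (y - x)" "\<bar>d\<bar> \<le> 2 * (y - x)" using \<open>x \<le> y\<close> by (auto simp: c_def d_def)
    have "\<bar>L_curve p q y $ i - L_curve p q x $ i\<bar> = \<bar>(p $ i - ?m $ i) * c + (q $ i - ?m $ i) * d\<bar>"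
      by (simp add: L_curve_component c_def d_def algebra_simps)
    also have "\<dots> \<le> \<bar>p $ i - ?m $ i\<bar> * \<bar>c\<bar> + \<bar>q $ i - ?m $ i\<bar> * \<bar>d\<bar>"
      by (rule order_trans[OF abs_triangle_ineq]) (simp add: abs_mult)
    also have "\<dots> \<le> \<bar>p $ i - ?m $ i\<bar> * (2 * (y - x)) + \<bar>q $ i - ?m $ i\<bar> * (2 * (y - x))"
      using cd by (intro add_mono mult_left_mono) auto
    finally show "\<bar>L_curve p q y $ i - L_curve p q x $ i\<bar> \<le>
        (2 * \<bar>p $ i - ?m $ i\<bar> + 2 * \<bar>q $ i - ?m $ i\<bar>) * (y - x)"
      by (simp add: algebra_simps)
  qed
  moreover have "L_curve p q 0 = p" "L_curve p q 1 = q"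
    by (simp_all add: vec_eq_iff L_curve_component)
  ultimately show ?thesis by (auto simp: curves_def)
qed

text \<open>The minimal point lies coordinatewise between \<open>p\<close> and \<open>q\<close>, so
  the coefficients of the two \<open>max\<close> terms have opposite signs, and the terms themselves
  vary in opposite directions.\<close>

lemma fully_monotonic_L_curve: "fully_monotonic (L_curve p q)"
  unfolding fully_monotonic_def
proof
  fix i
  let ?m = "minimal_point p q $ i"
  have "(p $ i \<le> ?m \<and> ?m \<le> q $ i) \<or> (q $ i \<le> ?m \<and> ?m \<le> p $ i)"
    using ell_between by (simp add: minimal_point_def)
  then show "mono_on {0..1} (\<lambda>t. L_curve p q t $ i) \<or> antimono_on {0..1} (\<lambda>t. L_curve p q t $ i)"
  proof
    assume "p $ i \<le> ?m \<and> ?m \<le> q $ i"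
    then have "mono_on {0..1} (\<lambda>t. L_curve p q t $ i)"
      unfolding L_curve_component
      by (intro mono_onI add_mono order_refl mult_left_mono mult_left_mono_neg) auto
    then show ?thesis ..
  next
    assume "q $ i \<le> ?m \<and> ?m \<le> p $ i"
    then have "antimono_on {0..1} (\<lambda>t. L_curve p q t $ i)"
      unfolding L_curve_component
      by (intro monotone_onI add_mono order_refl mult_left_mono mult_left_mono_neg) auto
    then show ?thesis ..
  qed
qed

lemma minimal_point_in_L_curve: "minimal_point p q \<in> L_curve p q ` {0..1}"
  by (rule image_eqI[of _ _ "1 / 2"]) (simp_all add: vec_eq_iff L_curve_component)

theorem theorem1:
  fixes p q :: "real ^ 'n" and \<gamma> :: "real \<Rightarrow> real ^ 'n"
  assumes "CARD('n) \<ge> 2"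
    and "p \<in> taxi_ball" and "q \<in> taxi_ball"
    and "\<gamma> \<in> curves p q"
  shows "curve_length 0 1 \<gamma> \<ge> curve_length 0 1 (L_curve p q) \<and>
    (curve_length 0 1 \<gamma> = curve_length 0 1 (L_curve p q) \<longleftrightarrow>
      fully_monotonic \<gamma> \<and> minimal_point p q \<in> \<gamma> ` {0..1})"
proof -
  \<comment> \<open>The L-shaped curve meets the equality criterion, so its length is the lower
    bound valid for all curves.\<close>
  have "curve_length 0 1 (L_curve p q) =
      artanh (taxi_norm p) + artanh (taxi_norm q) - 2 * artanh (taxi_norm (minimal_point p q))"
    using curve_length_characterization(2)[OF L_curve_in_curves[OF assms(2,3)]]
      fully_monotonic_L_curve minimal_point_in_L_curve by blast
  then show ?thesis
    using curve_length_characterization[OF assms(4)] by simp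
qed

end
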